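(* Let $\mathcal R_{\mathrm{LCFG}}$ be the encoding system for linear context-free grammars and $\mathcal C_{\mathrm{CFG}}$ the complexity measure mapping (the encoding of) a context-free grammar $G=(N,T,P,S)$, $T=\{0,1\}$, to $|N|+|T|+|P|$. Then for any learning algorithm $\mathcal A$, the length complexity $c\mapsto N^{\mathcal R_{\mathrm{LCFG}}}_{\mathcal A}(c)$ is not computably bounded. That is, the class of linear context-free grammars does not admit non-asymptotic length generalization (w.r.t. the standard CFG encoding system $\mathcal R_{\mathrm{CFG}}$ and $\mathcal C_{\mathrm{CFG}}$), and neither does the class of all context-free grammars.
   Context: Strings are over $\{0,1\}$; $\{0,1\}^*$ contains the empty string. Encoding system: a Turing machine $\mathcal R$ which, on input any string $p\in\{0,1\}^*$, outputs the description of a Turing machine computing a total function $\{0,1\}^*\to\{0,1\}$, denoted $\mathcal R(p)$. Put $\mathcal F^{\mathcal R}=\{\mathcal R(p):p\in\{0,1\}^*\}$. Functions to $\{0,1\}$ are identified with languages. A context-free grammar (CFG) is $G=(N,T=\{0,1\},P,S)$ with $N$ a finite set of nonterminals, $P$ a finite set of rules $A\to\alpha$, $A\in N$, $\alpha\in(N\cup T)^*$, and start symbol $S\in N$. $\langle G\rangle\in\{0,1\}^*$ is a binary encoding of $G$. $\mathcal R_{\mathrm{CFG}}(\langle G\rangle)$ is the indicator function of the language generated by $G$; strings not encoding a CFG are mapped to the empty language. A linear CFG is a CFG in which every rule has at most one nonterminal on its right-hand side. $\mathcal R_{\mathrm{LCFG}}(p)=\mathcal R_{\mathrm{CFG}}(p)$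 if $p$ encodes a linear CFG, and $\mathcal R_{\mathrm{LCFG}}(p)$ is the empty language otherwise. $\mathcal F_{\mathrm{LCFG}}\subseteq \mathcal F^{\mathcal R_{\mathrm{CFG}}}$ denotes the set of languages generated by linear CFGs. Complexity measure: a map $\mathcal C:\{0,1\}^*\to\mathbb N$. Here $\mathcal C_{\mathrm{CFG}}(\langle G\rangle)=|N|+|T|+|P|$, where $|P|$ is the total length of the production rules; this is within a constant factor of the bit length of $\langle G\rangle$. Standing assumption on any complexity measure $\mathcal C$ (for all strings, including those not encoding a grammar): $\mathcal C$ is computable; there is a Turing machine $E$ enumerating all of $\{0,1\}^*$ in non-decreasing order of $\mathcal C$; and $\{p:\mathcal C(p)\le c\}$ is finite for each $c$. For $f\in\mathcal F^{\mathcal R}$, $\mathcal C^{\mathcal R}(f)=\min\{\mathcal C(p):\mathcal R(p)=f\}$. Training data: $D_N(f)=\{(x,f(x)):x\in\{0,1\}^*,|x|\le N\}$. A learning algorithm is a Turing machine $\mathcal A$ that takes a training set $D_N(f)$ and outputs a string. $N^{\mathcal R}_{\mathcal A}(f)=\min\{N\ge 0:\forall n\ge N,\ \mathcal R(\mathcal A(D_n(f)))=f\}$ ($\infty$ if none), and $N^{\mathcal R}_{\mathcal A}(c)=\max\{N^{\mathcal R}_{\mathcal A}(f): f\in\mathcal F^{\mathcal R},\ \mathcal C^{\mathcal R}(f)\le c\}$ (with $\mathcal C=\mathcal C_{\mathrm{CFG}}$ here). A function $g:\mathbb N\to\mathbb N\cup\{\infty\}$ is computably bounded if there is a total computable $h:\mathbb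 N\to\mathbb N$ with $g(n)\le h(n)$ for all $n$. A class $\mathcal F\subseteq\mathcal F^{\mathcal R}$ admits non-asymptotic length generalization w.r.t. $\mathcal R,\mathcal C$ if there exist a learning algorithm $\mathcal A$ and a computable $\hat N:\mathbb N\to\mathbb N$ such that for all $f\in\mathcal F$ and all $N'\ge\hat N(\mathcal C^{\mathcal R}(f))$, $\mathcal R(\mathcal A(D_{N'}(f)))=f$. "The class of linear CFGs" refers to $\mathcal F=\mathcal F_{\mathrm{LCFG}}$ and "the class of all CFGs" to $\mathcal F=\mathcal F^{\mathcal R_{\mathrm{CFG}}}$. *)

theory Defs
  imports
    Complex_Main
    "HOL-Library.Extended_Nat"
    "HOL-Library.List_Lenlexorder"
    "HOL-Library.Product_Lexorder"
begin

type_synonym str = "bool list"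
type_synonym lang = "str \<Rightarrow> bool"

section \<open>Turing machines\<close>

text \<open>
  Deterministic Turing machines with one two-way infinite tape.  The states are the numbers
  below \<open>tm_states\<close> (start state 0), the tape symbols are the numbers below \<open>tm_syms\<close>.
  Symbol 0 is the blank, 1 and 2 stand for the bits 0 and 1, and 3 is a separator that is used
  only to lay out training data.  The machine halts when the transition function is undefined.
\<close>

datatype move = MLeft | MStay | MRight

record tm =
  tm_states :: nat
  tm_syms :: nat
  tm_delta :: "nat \<Rightarrow> nat \<Rightarrow> (nat \<times> nat \<times> move) option"

definition tm_wf :: "tm \<Rightarrow> bool" where
  "tm_wf M \<longleftrightarrow> 0 < tm_states M \<and> 4 \<le> tm_syms M \<and>
     (\<forall>q a q' b m. q < tm_states M \<longrightarrow> a < tm_syms M \<longrightarrow> tm_delta M q a = Some (q', b, m) \<longrightarrow>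
        q' < tm_states M \<and> b < tm_syms M)"

text \<open>
  In a configuration \<open>(q, ls, rs)\<close> the list \<open>ls\<close> is the tape left of the head, nearest cell first,
  and \<open>rs\<close> is the tape from the scanned cell rightwards; all cells beyond the lists are blank.
\<close>

type_synonym config = "nat \<times> nat list \<times> nat list"

definition scan :: "nat list \<Rightarrow> nat" where
  "scan xs = (case xs of [] \<Rightarrow> 0 | x # _ \<Rightarrow> x)"

fun tm_step :: "tm \<Rightarrow> config \<Rightarrow> config option" where
  "tm_step M (q, ls, rs) =
     (case tm_delta M q (scan rs) of
        None \<Rightarrow> None
      | Some (q', b, m) \<Rightarrow> Some
          (case m of
             MLeft \<Rightarrow> (q', tl ls, scan ls # b # tl rs)
           | MStay \<Rightarrow> (q', ls, b # tl rs)
           | MRight \<Rightarrow> (q', b # ls, tl rs)))"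

text \<open>
  The input is written from the head rightwards; the output of a halting run is the word read
  from the head rightwards up to the first blank.
\<close>

definition tm_outputs :: "tm \<Rightarrow> nat list \<Rightarrow> nat list \<Rightarrow> bool" where
  "tm_outputs M u v \<longleftrightarrow>
     (\<exists>q ls rs. (\<lambda>c c'. tm_step M c = Some c')\<^sup>*\<^sup>* (0, [], u) (q, ls, rs) \<and>
        tm_step M (q, ls, rs) = None \<and> takeWhile (\<lambda>a. a \<noteq> 0) rs = v)"

text \<open>Computability of a function on a set of inputs, relative to tape encodings.\<close>

definition tm_computable_on ::
    "'a set \<Rightarrow> ('a \<Rightarrow> nat list) \<Rightarrow> ('b \<Rightarrow> nat list) \<Rightarrow> ('a \<Rightarrow> 'b) \<Rightarrow> bool" where
  "tm_computable_on X ein eout f \<longleftrightarrow>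
     (\<exists>M. tm_wf M \<and> (\<forall>x\<in>X. tm_outputs M (ein x) (eout (f x))))"

definition tape_bit :: "bool \<Rightarrow> nat" where
  "tape_bit b = (if b then 2 else 1)"

definition tape_str :: "str \<Rightarrow> nat list" where
  "tape_str w = map tape_bit w"

text \<open>Natural numbers are written in unary, as strings of ones.\<close>

definition tape_nat :: "nat \<Rightarrow> nat list" where
  "tape_nat n = tape_str (replicate n True)"

section \<open>Training data and learning algorithms\<close>

type_synonym sample = "(str \<times> bool) set"

definition training_data :: "nat \<Rightarrow> lang \<Rightarrow> sample" where
  "training_data N f = {(x, f x) | x. length x \<le> N}"

text \<open>
  A finite set of labelled strings is listed in shortlex order of the strings (this is the order
  on lists provided by \<open>List_Lenlexorder\<close>), the pair \<open>(x, y)\<close> being written as \<open>x;y;\<close>.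
\<close>

definition tape_sample :: "sample \<Rightarrow> nat list" where
  "tape_sample D =
     concat (map (\<lambda>(x, y). tape_str x @ [3, tape_bit y, 3]) (sorted_list_of_set D))"

definition learning_algorithm :: "(sample \<Rightarrow> str) \<Rightarrow> bool" where
  "learning_algorithm A \<longleftrightarrow>
     tm_computable_on {training_data N f | N f. True} tape_sample tape_str A"

section \<open>Encoding systems, complexity and length generalization\<close>

text \<open>
  An encoding system enters all of the following notions only through the map sending a
  string to the (total) function that the string describes.
\<close>

type_synonym encoding_system = "str \<Rightarrow> lang"

text \<open>
  The enumerating machine is rendered as a machine computing the \<open>i\<close>-th string of the
  enumeration from \<open>i\<close>.
\<close>

definition complexity_measure :: "(str \<Rightarrow> nat) \<Rightarrow> bool" where
  "complexity_measure C \<longleftrightarrow>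
     tm_computable_on UNIV tape_str tape_nat C \<and>
     (\<exists>e. tm_computable_on UNIV tape_nat tape_str e \<and> surj e \<and> mono (\<lambda>i. C (e i))) \<and>
     (\<forall>c. finite {p. C p \<le> c})"

text \<open>Only meaningful for \<open>f\<close> in the range of \<open>R\<close>.\<close>

definition fun_complexity :: "encoding_system \<Rightarrow> (str \<Rightarrow> nat) \<Rightarrow> lang \<Rightarrow> nat" where
  "fun_complexity R C f = (LEAST k. \<exists>p. R p = f \<and> C p = k)"

text \<open>The infimum of the empty set in \<open>enat\<close> is \<open>\<infinity>\<close>.\<close>

definition length_complexity_fun ::
    "encoding_system \<Rightarrow> (sample \<Rightarrow> str) \<Rightarrow> lang \<Rightarrow> enat" where
  "length_complexity_fun R A f =
     Inf {enat N | N. \<forall>n\<ge>N. R (A (training_data n f)) = f}"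

text \<open>
  For a complexity measure only finitely many functions have complexity at most \<open>c\<close>, so the
  supremum is a maximum; it is 0 when there is no such function.
\<close>

definition length_complexity ::
    "encoding_system \<Rightarrow> (str \<Rightarrow> nat) \<Rightarrow> (sample \<Rightarrow> str) \<Rightarrow> nat \<Rightarrow> enat" where
  "length_complexity R C A c =
     Sup {length_complexity_fun R A f | f. f \<in> range R \<and> fun_complexity R C f \<le> c}"

definition computable_nat_fun :: "(nat \<Rightarrow> nat) \<Rightarrow> bool" where
  "computable_nat_fun h \<longleftrightarrow> tm_computable_on UNIV tape_nat tape_nat h"

definition computably_bounded :: "(nat \<Rightarrow> enat) \<Rightarrow> bool" where
  "computably_bounded g \<longleftrightarrow> (\<exists>h. computable_nat_fun h \<and> (\<forall>n. g n \<le> enat (h n)))"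

definition admits_length_generalization ::
    "encoding_system \<Rightarrow> (str \<Rightarrow> nat) \<Rightarrow> lang set \<Rightarrow> bool" where
  "admits_length_generalization R C F \<longleftrightarrow>
     (\<exists>A Nhat. learning_algorithm A \<and> computable_nat_fun Nhat \<and>
        (\<forall>f\<in>F. \<forall>N'\<ge>Nhat (fun_complexity R C f). R (A (training_data N' f)) = f))"

section \<open>Context-free grammars over the terminal alphabet of bits\<close>

datatype symb = NT nat | T bool

record cfg =
  nonterminals :: "nat set"
  rules :: "(nat \<times> symb list) set"
  start :: nat

definition is_cfg :: "cfg \<Rightarrow> bool" where
  "is_cfg G \<longleftrightarrow> finite (nonterminals G) \<and> finite (rules G) \<and> start G \<in> nonterminals G \<and>
     (\<forall>(A, \<alpha>)\<in>rules G. A \<in> nonterminals G \<and> (\<forall>B. NT B \<in> set \<alpha> \<longrightarrow> B \<in> nonterminals G))"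

definition derives1 :: "cfg \<Rightarrow> symb list \<Rightarrow> symb list \<Rightarrow> bool" where
  "derives1 G \<phi> \<psi> \<longleftrightarrow>
     (\<exists>u A v \<alpha>. (A, \<alpha>) \<in> rules G \<and> \<phi> = u @ [NT A] @ v \<and> \<psi> = u @ \<alpha> @ v)"

definition cfg_lang :: "cfg \<Rightarrow> lang" where
  "cfg_lang G = (\<lambda>w. (derives1 G)\<^sup>*\<^sup>* [NT (start G)] (map T w))"

definition linear_cfg :: "cfg \<Rightarrow> bool" where
  "linear_cfg G \<longleftrightarrow> is_cfg G \<and>
     (\<forall>(A, \<alpha>)\<in>rules G. length (filter (\<lambda>X. \<exists>B. X = NT B) \<alpha>) \<le> 1)"

text \<open>
  The length of a rule \<open>A \<rightarrow> \<alpha>\<close> is that of \<open>A\<alpha>\<close>; the summand 2 is the size of the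
  terminal alphabet.
\<close>

definition cfg_size :: "cfg \<Rightarrow> nat" where
  "cfg_size G = card (nonterminals G) + 2 + (\<Sum>(A, \<alpha>)\<in>rules G. 1 + length \<alpha>)"

text \<open>
  Names of nonterminals are immaterial: every grammar can be renamed, without changing its
  language, its size or its linearity, so that its nonterminals are \<open>0, \<dots>, n - 1\<close>.  Strings encode
  grammars in this form; otherwise infinitely many strings would have the same complexity.
\<close>

definition standard_cfg :: "cfg \<Rightarrow> bool" where
  "standard_cfg G \<longleftrightarrow> is_cfg G \<and> nonterminals G = {..<card (nonterminals G)}"

text \<open>
  The encoding of grammars as strings is a parameter.  Effectiveness is not demanded, so every
  effective encoding is covered.
\<close>

definition cfg_encoding :: "(cfg \<Rightarrow> str) \<Rightarrow> bool" where
  "cfg_encoding enc \<longleftrightarrow> inj_on enc {G. standard_cfg G}"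

definition R_CFG :: "(cfg \<Rightarrow> str) \<Rightarrow> encoding_system" where
  "R_CFG enc p =
     (if \<exists>G. standard_cfg G \<and> enc G = p
      then cfg_lang (THE G. standard_cfg G \<and> enc G = p)
      else (\<lambda>_. False))"

definition R_LCFG :: "(cfg \<Rightarrow> str) \<Rightarrow> encoding_system" where
  "R_LCFG enc p =
     (if \<exists>G. standard_cfg G \<and> linear_cfg G \<and> enc G = p then R_CFG enc p else (\<lambda>_. False))"

definition F_LCFG :: "lang set" where
  "F_LCFG = {cfg_lang G | G. linear_cfg G}"

text \<open>
  The complexity of a string that encodes no grammar is left open, subject to the
  requirements on every complexity measure.
\<close>

definition cfg_complexity :: "(cfg \<Rightarrow> str) \<Rightarrow> (str \<Rightarrow> nat) \<Rightarrow> bool" where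
  "cfg_complexity enc C \<longleftrightarrow>
     complexity_measure C \<and> (\<forall>G. standard_cfg G \<longrightarrow> C (enc G) = cfg_size G)"

end

theory Submission
  imports Defs
begin

text \<open>
  If a learning algorithm succeeded from a length that is computable from the complexity, then two
  linear grammars of size at most \<open>m\<close> would be equivalent as soon as they agree on the words of length
  at most the maximum of \<open>h 0, \<dots>, h m\<close>, for a computable function \<open>h\<close>.  This is refuted by a
  diagonal argument, with one of the two grammars generating all words.

  Let the machine \<open>M\<close> compute \<open>h\<close> in unary.  A valid word records the computations of \<open>M\<close> on the
  inputs \<open>j, j - 1, \<dots>, 0\<close>, row by row, on a tape segment of fixed length; so the segment, and the word,
  are longer than each of \<open>h 0, \<dots>, h j\<close>.  It is moreover required that \<open>j\<close> is positive and divisible by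
  \<open>n\<close> and \<open>n + 1\<close>, hence \<open>j \<ge> n (n + 1)\<close>.  The words that are not valid form a linear language: each
  possible defect is recognised by a finite automaton or by comparing two adjacent rows from the outside
  inwards.  Only the two divisibility tests depend on \<open>n\<close>, so the grammar has size linear in \<open>n\<close>,
  which is less than \<open>n (n + 1)\<close> for large \<open>n\<close>.
\<close>

section \<open>Linear rewriting systems\<close>

text \<open>The length from which learning succeeds is \<open>h\<close> of the exact complexity of a
  language. That complexity is only known to be at most \<open>m\<close>, and \<open>h\<close> need
  not be monotone, so a missing word has to outgrow \<open>h i\<close> for every
  \<open>i \<le> m\<close>; recording the runs on all smaller inputs achieves this without a second
  machine that computes a maximum. A halted machine has overwritten its input. Each cell therefore
  carries a mark that every step copies: 0, 1 and 2 delimit left margin, input and right margin, and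
  the next input arises by moving one boundary by one cell. The obstacle is to force
  \<open>j\<close> beyond the size of the very grammar that tests it. An automaton counting up to
  \<open>m\<close> would need about \<open>m\<close> states, whereas the coprime moduli
  \<open>n\<close> and \<open>n + 1\<close> cost about \<open>2 n\<close> states and force a number
  quadratic in \<open>n\<close>. The machine \<open>M\<close> enters only through the alphabet and
  the comparison automata, hence as a constant. Because \<open>M\<close> halts on every input, some
  valid word exists, so the complement differs from the set of all words.\<close>

type_synonym ('s, 'a) lrule = "'s \<times> 'a list \<times> ('s \<times> 'a list) option"

inductive lgen :: "('s, 'a) lrule set \<Rightarrow> 's \<Rightarrow> 'a list \<Rightarrow> bool" for R where
  lgen_stop: "(A, x, None) \<in> R \<Longrightarrow> lgen R A x"
| lgen_go: "(A, x, Some (B, y)) \<in> R \<Longrightarrow> lgen R B w \<Longrightarrow> lgen R A (x @ w @ y)"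

lemma lgen_go': "(A, x, Some (B, y)) \<in> R \<Longrightarrow> lgen R B w \<Longrightarrow> v = x @ w @ y \<Longrightarrow> lgen R A v"
  by (simp only:) (rule lgen_go)

lemma lgen_mono: "lgen R A w \<Longrightarrow> R \<subseteq> R' \<Longrightarrow> lgen R' A w"
proof (induction rule: lgen.induct)
  case (lgen_stop A x)
  then show ?case by (intro lgen.lgen_stop) blast
next
  case (lgen_go A x B y w)
  show ?case by (rule lgen.lgen_go) (use lgen_go in blast)+
qed

fun rule_width :: "('s, 'a) lrule \<Rightarrow> nat" where
  "rule_width (A, x, None) = length x"
| "rule_width (A, x, Some (B, y)) = length x + length y"

fun rule_states :: "('s, 'a) lrule \<Rightarrow> 's set" where
  "rule_states (A, x, None) = {A}"
| "rule_states (A, x, Some (B, y)) = {A, B}"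

definition map_rule :: "('s \<Rightarrow> 't) \<Rightarrow> ('a list \<Rightarrow> 'b list) \<Rightarrow> ('s, 'a) lrule \<Rightarrow> ('t, 'b) lrule" where
  "map_rule f g = (\<lambda>(A, x, r). (f A, g x, map_option (\<lambda>(B, y). (f B, g y)) r))"

lemma map_rule_simps [simp]:
  "map_rule f g (A, x, None) = (f A, g x, None)"
  "map_rule f g (A, x, Some (B, y)) = (f A, g x, Some (f B, g y))"
  by (simp_all add: map_rule_def)

lemma in_map_rule_None: "(A, x, None) \<in> map_rule f g ` R \<longleftrightarrow>
    (\<exists>A' x'. (A', x', None) \<in> R \<and> A = f A' \<and> x = g x')"
  by (force simp: map_rule_def split: prod.splits)

lemma in_map_rule_Some: "(A, x, Some (B, y)) \<in> map_rule f g ` R \<longleftrightarrow>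
    (\<exists>A' x' B' y'. (A', x', Some (B', y')) \<in> R \<and> A = f A' \<and> x = g x' \<and> B = f B' \<and> y = g y')"
  (is "?l = ?r")
proof
  assume ?l
  then obtain A' x' q where q: "(A', x', q) \<in> R" "(A, x, Some (B, y)) = map_rule f g (A', x', q)" by auto
  then obtain B' y' where "q = Some (B', y')" by (cases q) auto
  then show ?r using q by auto
next
  assume ?r
  then obtain A' x' B' y' where "(A', x', Some (B', y')) \<in> R"
    "(A, x, Some (B, y)) = map_rule f g (A', x', Some (B', y'))" by auto
  then show ?l by (rule rev_image_eqI)
qed

lemma rule_states_finite: "finite (rule_states r)"
  by (cases r rule: rule_states.cases) auto

lemma rule_states_card: "card (rule_states r) \<le> 2"
  by (cases r rule: rule_states.cases) (auto simp: card_insert_if)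

text \<open>Injectivity is asked only on the states that occur, because a renaming of an arbitrary
  state type into numbers is injective only on such a finite set.\<close>

lemma lgen_map_states:
  assumes inj: "inj_on f X" and sub: "\<Union>(rule_states ` R) \<subseteq> X" and "S \<in> X"
  shows "lgen (map_rule f id ` R) (f S) w \<longleftrightarrow> lgen R S w"
proof
  have "lgen (map_rule f id ` R) B w \<Longrightarrow> \<forall>S\<in>X. B = f S \<longrightarrow> lgen R S w" for B
  proof (induction rule: lgen.induct)
    case (lgen_stop A x)
    then obtain A' where A': "(A', x, None) \<in> R" "A = f A'"
      by (auto simp: in_map_rule_None)
    then have "A' \<in> X" using sub by force
    then show ?case using A' inj by (metis inj_onD lgen.lgen_stop)
  next
    case (lgen_go A x B y w)
    then obtain A' B' where A': "(A', x, Some (B', y)) \<in> R" "A = f A'" "B = f B'"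
      by (auto simp: in_map_rule_Some)
    then have "A' \<in> X" "B' \<in> X" using sub by force+
    then show ?case using A' inj lgen_go.IH by (metis inj_onD lgen.lgen_go)
  qed
  then show "lgen (map_rule f id ` R) (f S) w \<Longrightarrow> lgen R S w" using \<open>S \<in> X\<close> by blast
  show "lgen R S w \<Longrightarrow> lgen (map_rule f id ` R) (f S) w"
  proof (induction rule: lgen.induct)
    case (lgen_stop A x)
    then have "(f A, x, None) \<in> map_rule f id ` R" by force
    then show ?case by (rule lgen.lgen_stop)
  next
    case (lgen_go A x B y w)
    then have "(f A, x, Some (f B, y)) \<in> map_rule f id ` R" by force
    then show ?case using lgen_go.IH by (rule lgen.lgen_go)
  qed
qed

text \<open>Width and number of rules are tracked separately: the width will stay fixed while the
  number of rules grows linearly in \<open>n\<close>.\<close>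

definition lin :: "nat \<Rightarrow> nat \<Rightarrow> 'a list set \<Rightarrow> bool" where
  "lin b r L \<longleftrightarrow> (\<exists>(R :: (nat, 'a) lrule set) S. finite R \<and> card R \<le> r \<and>
     (\<forall>\<rho>\<in>R. rule_width \<rho> \<le> b) \<and> L = {w. lgen R S w})"

lemma rule_width_map_states: "rule_width (map_rule f id \<rho>) = rule_width \<rho>"
  by (cases \<rho> rule: rule_states.cases) auto

lemma finite_rules_states: "finite R \<Longrightarrow> finite (\<Union>(rule_states ` R))"
  by (auto simp: rule_states_finite)

lemma linI:
  fixes R :: "('s, 'a) lrule set"
  assumes "finite R" "card R \<le> r" "\<And>\<rho>. \<rho> \<in> R \<Longrightarrow> rule_width \<rho> \<le> b" "L = {w. lgen R S w}"
  shows "lin b r L"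
proof -
  let ?X = "insert S (\<Union>(rule_states ` R))"
  obtain f :: "'s \<Rightarrow> nat" where f: "inj_on f ?X"
    using finite_imp_inj_to_nat_seg[of ?X] finite_rules_states[OF assms(1)] by auto
  let ?R = "map_rule f id ` R"
  have "L = {w. lgen ?R (f S) w}"
    unfolding assms(4) using lgen_map_states[OF f, of R S] by auto
  moreover have "card ?R \<le> r" using assms(2) by (rule le_trans[OF card_image_le[OF assms(1)]])
  ultimately show ?thesis unfolding lin_def using assms(1,3)
    by (intro exI[of _ ?R] exI[of _ "f S"]) (auto simp: rule_width_map_states)
qed

lemma linE:
  assumes "lin b r L"
  obtains R :: "(nat, 'a) lrule set" and S where "finite R" "card R \<le> r"
    "\<forall>\<rho>\<in>R. rule_width \<rho> \<le> b" "L = {w. lgen R S w}"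
  using assms unfolding lin_def by blast

lemma lin_mono: "lin b r (L :: 'a list set) \<Longrightarrow> b \<le> b' \<Longrightarrow> r \<le> r' \<Longrightarrow> lin b' r' L"
proof -
  assume "lin b r L" "b \<le> b'" "r \<le> r'"
  then obtain R S where R: "finite R" "card R \<le> r" "\<forall>\<rho>\<in>R. rule_width \<rho> \<le> b"
    "L = {w. lgen (R :: (nat, 'a) lrule set) S w}" by (elim linE)
  show ?thesis by (rule linI[OF R(1) _ _ R(4)]) (use R \<open>b \<le> b'\<close> \<open>r \<le> r'\<close> in \<open>fastforce\<close>)+
qed

text \<open>The fresh start state \<open>None\<close> and its two rules account for the summand 2;
  the tags \<open>Inl\<close> and \<open>Inr\<close> keep the two systems apart.\<close>

lemma lin_Un:
  fixes L1 L2 :: "'a list set"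
  assumes "lin b r1 L1" "lin b r2 L2"
  shows "lin b (r1 + r2 + 2) (L1 \<union> L2)"
proof -
  from assms(1) obtain R1 :: "(nat, 'a) lrule set" and S1 where 1: "finite R1" "card R1 \<le> r1" "\<forall>\<rho>\<in>R1. rule_width \<rho> \<le> b"
    "L1 = {w. lgen R1 S1 w}"
    by (rule linE)
  from assms(2) obtain R2 :: "(nat, 'a) lrule set" and S2 where 2: "finite R2" "card R2 \<le> r2" "\<forall>\<rho>\<in>R2. rule_width \<rho> \<le> b"
    "L2 = {w. lgen R2 S2 w}"
    by (rule linE)
  let ?J = "map_rule (\<lambda>n. Some (Inl n :: nat + nat)) id ` R1"
  let ?K = "map_rule (\<lambda>n. Some (Inr n :: nat + nat)) id ` R2"
  let ?I = "{(None, [], Some (Some (Inl S1), [])), (None, [], Some (Some (Inr S2), []))} :: ((nat + nat) option, 'a) lrule set"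
  let ?R = "?I \<union> ?J \<union> ?K"
  have g1: "lgen ?J (Some (Inl A)) w \<longleftrightarrow> lgen R1 A w" for A w
    by (rule lgen_map_states[of _ UNIV]) (auto simp: inj_on_def)
  have g2: "lgen ?K (Some (Inr A)) w \<longleftrightarrow> lgen R2 A w" for A w
    by (rule lgen_map_states[of _ UNIV]) (auto simp: inj_on_def)
  have sound: "lgen ?R B w \<Longrightarrow> case B of None \<Rightarrow> lgen R1 S1 w \<or> lgen R2 S2 w
      | Some (Inl A) \<Rightarrow> lgen R1 A w | Some (Inr A) \<Rightarrow> lgen R2 A w" for B w
  proof (induction rule: lgen.induct)
    case (lgen_stop A x)
    then show ?case
      by (auto simp: in_map_rule_None intro: lgen.intros)
  next
    case (lgen_go A x B y w)
    then show ?case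
      by (auto simp: in_map_rule_Some intro: lgen.intros)
  qed
  have "lgen ?R None w" if "lgen R1 S1 w" for w
  proof (rule lgen_go'[where x = "[]" and y = "[]"])
    have "lgen ?J (Some (Inl S1)) w" using that by (simp only: g1)
    then show "lgen ?R (Some (Inl S1)) w" by (rule lgen_mono) blast
  qed simp_all
  moreover have "lgen ?R None w" if "lgen R2 S2 w" for w
  proof (rule lgen_go'[where x = "[]" and y = "[]"])
    have "lgen ?K (Some (Inr S2)) w" using that by (simp only: g2)
    then show "lgen ?R (Some (Inr S2)) w" by (rule lgen_mono) blast
  qed simp_all
  ultimately have eq: "L1 \<union> L2 = {w. lgen ?R None w}"
    unfolding 1(4) 2(4) using sound[of None] by auto
  have "card ?R \<le> card ?I + card ?J + card ?K"
    using card_Un_le[of "?I \<union> ?J" ?K] card_Un_le[of ?I ?J] by linarith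
  moreover have "card ?J \<le> r1" using 1(2) by (rule le_trans[OF card_image_le[OF 1(1)]])
  moreover have "card ?K \<le> r2" using 2(2) by (rule le_trans[OF card_image_le[OF 2(1)]])
  moreover have "card ?I \<le> 2" by (simp add: card_insert_if)
  ultimately have card: "card ?R \<le> r1 + r2 + 2" by linarith
  have width: "rule_width \<rho> \<le> b" if "\<rho> \<in> ?R" for \<rho>
    using that 1(3) 2(3) by (auto simp: rule_width_map_states)
  have "finite ?R" using 1(1) 2(1) by simp
  then show ?thesis using card width eq by (rule linI)
qed

lemma length_concat_map_le:
  "(\<And>a. length (f a) \<le> k) \<Longrightarrow> length (concat (map f w)) \<le> k * length w"
  by (induction w) (auto intro: add_mono)

text \<open>Encoding the terminal blocks inside the rules adds no rule and no state; only the width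
  grows, at most by the factor \<open>k\<close>.\<close>

lemma lin_concat_map:
  fixes L :: "'a list set"
  assumes "lin b r L" and k: "\<And>a. length (code a) \<le> k"
  shows "lin (k * b) r ((\<lambda>w. concat (map code w)) ` L)"
proof -
  from assms(1) obtain R :: "(nat, 'a) lrule set" and S where 1: "finite R" "card R \<le> r" "\<forall>\<rho>\<in>R. rule_width \<rho> \<le> b"
    "L = {w. lgen R S w}"
    by (rule linE)
  let ?c = "\<lambda>w. concat (map code w)"
  let ?R = "map_rule id ?c ` R"
  have "lgen ?R A x \<Longrightarrow> \<exists>w. x = ?c w \<and> lgen R A w" for A x
  proof (induction rule: lgen.induct)
    case (lgen_stop A x)
    then show ?case
      by (auto simp: in_map_rule_None intro: lgen.intros)
  next
    case (lgen_go A x B y w)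
    then obtain x' y' w' where "(A, x', Some (B, y')) \<in> R" "x = ?c x'" "y = ?c y'" "w = ?c w'" "lgen R B w'"
      by (auto simp: in_map_rule_Some)
    then show ?case by (intro exI[of _ "x' @ w' @ y'"]) (auto intro: lgen.intros)
  qed
  moreover have "lgen R A w \<Longrightarrow> lgen ?R A (?c w)" for A w
  proof (induction rule: lgen.induct)
    case (lgen_stop A x)
    then have "(A, ?c x, None) \<in> ?R" by force
    then show ?case by (rule lgen.lgen_stop)
  next
    case (lgen_go A x B y w)
    then have "(A, ?c x, Some (B, ?c y)) \<in> ?R" by force
    from lgen.lgen_go[OF this lgen_go.IH] show ?case by simp
  qed
  ultimately have eq: "?c ` L = {w. lgen ?R S w}" unfolding 1(4) by auto
  have "rule_width (map_rule id ?c \<rho>) \<le> k * rule_width \<rho>" for \<rho>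
    by (cases \<rho> rule: rule_states.cases)
      (auto simp: add_mult_distrib2 intro!: add_mono length_concat_map_le k)
  then have width: "rule_width \<rho> \<le> k * b" if "\<rho> \<in> ?R" for \<rho>
    using that 1(3) by (metis (no_types, lifting) imageE le_trans mult_le_mono2)
  have card: "card ?R \<le> r" using 1(2) by (rule le_trans[OF card_image_le[OF 1(1)]])
  have "finite ?R" using 1(1) by simp
  then show ?thesis using card width eq by (rule linI)
qed

subsection \<open>Linear grammars\<close>

fun rule_rhs :: "bool list \<times> (nat \<times> bool list) option \<Rightarrow> symb list" where
  "rule_rhs (x, None) = map T x"
| "rule_rhs (x, Some (B, y)) = map T x @ NT B # map T y"

lemma derives1_context: "derives1 G \<phi> \<psi> \<Longrightarrow> derives1 G (a @ \<phi> @ b) (a @ \<psi> @ b)"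
  unfolding derives1_def by (metis append.assoc)

lemma derives_context: "(derives1 G)\<^sup>*\<^sup>* \<phi> \<psi> \<Longrightarrow> (derives1 G)\<^sup>*\<^sup>* (a @ \<phi> @ b) (a @ \<psi> @ b)"
proof (induction rule: rtranclp_induct)
  case (step \<phi>' \<psi>')
  then show ?case by (meson derives1_context rtranclp.rtrancl_into_rtrancl)
qed simp

lemma NT_split_unique:
  "map T x @ NT A # map T y = u @ NT A' # v \<Longrightarrow> u = map T x \<and> A' = A \<and> v = map T y"
proof (induction x arbitrary: u)
  case Nil
  have "NT A' \<notin> set (map T y)" by auto
  then have "map T y \<noteq> l @ NT A' # v" for l by (metis in_set_conv_decomp)
  then show ?case using Nil by (cases u) auto
next
  case (Cons a x)
  then show ?case by (cases u) auto
qed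

text \<open>Starting from one nonterminal, every sentential form contains at most one. The induction
  therefore treats the two shapes \<open>map T x\<close> and
  \<open>map T x @ NT A # map T y\<close>; in the latter the rewritten position is unique.\<close>

lemma lgen_iff_derives:
  assumes R: "rules G = (\<lambda>(A, r). (A, rule_rhs r)) ` R"
  shows "(derives1 G)\<^sup>*\<^sup>* [NT A] (map T w) \<longleftrightarrow> lgen R A w"
proof
  have "(derives1 G)\<^sup>*\<^sup>* \<phi> (map T w) \<Longrightarrow> (\<forall>x. \<phi> = map T x \<longrightarrow> w = x) \<and>
      (\<forall>x A y. \<phi> = map T x @ NT A # map T y \<longrightarrow> (\<exists>z. w = x @ z @ y \<and> lgen R A z))" for \<phi>
  proof (induction rule: converse_rtranclp_induct)
    case base
    have "inj T" by (simp add: inj_def)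
    then have "map T w = map T x \<Longrightarrow> w = x" for x by simp
    moreover have "map T w \<noteq> map T x @ NT A # map T y" for x A y
      by (metis (no_types, opaque_lifting) ex_map_conv in_set_conv_decomp symb.distinct(1))
    ultimately show ?case by blast
  next
    case (step \<phi> \<psi>)
    then obtain u A' v r where uv: "(A', r) \<in> R" "\<phi> = u @ NT A' # v" "\<psi> = u @ rule_rhs r @ v"
      unfolding derives1_def R by auto
    have "\<phi> \<noteq> map T x" for x
      using uv by (metis (no_types, opaque_lifting) ex_map_conv in_set_conv_decomp symb.distinct(1))
    moreover have "\<exists>z. w = x @ z @ y \<and> lgen R A z" if "\<phi> = map T x @ NT A # map T y" for x A y
    proof -
      have s: "u = map T x" "A' = A" "v = map T y"
        using NT_split_unique[of x A y u A' v] that uv by auto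
      show ?thesis
      proof (cases r rule: rule_rhs.cases)
        case (1 a)
        then have "\<psi> = map T (x @ a @ y)" using uv s by simp
        then have "w = x @ a @ y" using step.IH by blast
        then show ?thesis using uv s 1 by (auto intro: lgen.intros)
      next
        case (2 a B b)
        then have "\<psi> = map T (x @ a) @ NT B # map T (b @ y)" using uv s by simp
        then obtain z where "w = (x @ a) @ z @ b @ y" "lgen R B z" using step.IH by blast
        then show ?thesis using uv s 2 by (intro exI[of _ "a @ z @ b"]) (auto intro: lgen.intros)
      qed
    qed
    ultimately show ?case by blast
  qed
  note * = this
  show "(derives1 G)\<^sup>*\<^sup>* [NT A] (map T w) \<Longrightarrow> lgen R A w"
    using *[of "[NT A]"] by (metis (no_types, lifting) append_Nil append_Nil2 list.simps(8))
  have d1: "derives1 G [NT A] (rule_rhs r)" if "(A, r) \<in> R" for A r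
    unfolding derives1_def R using that by force
  show "lgen R A w \<Longrightarrow> (derives1 G)\<^sup>*\<^sup>* [NT A] (map T w)"
  proof (induction rule: lgen.induct)
    case (lgen_stop A x)
    then show ?case using d1 by fastforce
  next
    case (lgen_go A x B y w)
    have "derives1 G [NT A] (map T x @ [NT B] @ map T y)" using d1[OF lgen_go(1)] by simp
    also have "(derives1 G)\<^sup>*\<^sup>* \<dots> (map T x @ map T w @ map T y)"
      by (rule derives_context[OF lgen_go.IH])
    finally show ?case by simp
  qed
qed

text \<open>The size adds up from 2 terminals, at most \<open>1 + 2 * r\<close> nonterminals (the
  start and two per rule), and at most \<open>r\<close> rules, each of length at most
  \<open>b + 2\<close>. The states are renamed onto an initial segment, as
  \<open>standard_cfg\<close> requires.\<close>

lemma lin_imp_linear_cfg: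
  assumes "lin b r L"
  shows "\<exists>G. standard_cfg G \<and> linear_cfg G \<and> cfg_lang G = (\<lambda>w. w \<in> L) \<and> cfg_size G \<le> 3 + r * (b + 4)"
proof -
  from assms(1) obtain R0 :: "(nat, bool) lrule set" and S where 1: "finite R0" "card R0 \<le> r" "\<forall>\<rho>\<in>R0. rule_width \<rho> \<le> b"
    "L = {w. lgen R0 S w}"
    by (rule linE)
  let ?X = "insert S (\<Union>(rule_states ` R0))"
  have finX: "finite ?X" using finite_rules_states[OF 1(1)] by blast
  then obtain f where f: "bij_betw f ?X {..<card ?X}"
    using ex_bij_betw_finite_nat[OF finX] by (auto simp: atLeast0LessThan)
  define R where "R = map_rule f id ` R0"
  define P where "P = (\<lambda>(A, r). (A, rule_rhs r)) ` R"
  define G where "G = \<lparr>nonterminals = {..<card ?X}, rules = P, start = f S\<rparr>"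
  have finR: "finite R" and cR: "card R \<le> r" and wR: "\<forall>\<rho>\<in>R. rule_width \<rho> \<le> b"
    using 1 card_image_le[of R0 "map_rule f id"] by (auto simp: R_def rule_width_map_states)
  have finP: "finite P" and cP: "card P \<le> r"
    using finR cR card_image_le[of R "\<lambda>(A, r). (A, rule_rhs r)"] by (auto simp: P_def)
  have fX: "f A < card ?X" if "A \<in> ?X" for A
    using bij_betwE[OF f] that by blast
  have st: "\<Union>(rule_states ` R) \<subseteq> {..<card ?X}"
  proof
    fix A assume "A \<in> \<Union>(rule_states ` R)"
    then obtain \<rho> where \<rho>: "\<rho> \<in> R0" "A \<in> rule_states (map_rule f id \<rho>)" by (auto simp: R_def)
    then have "A \<in> f ` rule_states \<rho>" by (cases \<rho> rule: rule_states.cases) auto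
    then show "A \<in> {..<card ?X}" using \<rho>(1) fX by blast
  qed
  have rhs: "A \<in> {..<card ?X} \<and> (\<forall>B. NT B \<in> set \<alpha> \<longrightarrow> B \<in> {..<card ?X}) \<and> length \<alpha> \<le> b + 1
      \<and> length (filter (\<lambda>X. \<exists>B. X = NT B) \<alpha>) \<le> 1" if in_P: "(A, \<alpha>) \<in> P" for A \<alpha>
  proof -
    obtain q where q: "(A, q) \<in> R" "\<alpha> = rule_rhs q" using in_P unfolding P_def by force
    have "rule_states (A, q) \<subseteq> {..<card ?X}" using q(1) st by blast
    then show ?thesis using q bspec[OF wR q(1)] by (cases q rule: rule_rhs.cases) (auto simp: filter_empty_conv)
  qed
  have lin: "linear_cfg G"
    unfolding linear_cfg_def is_cfg_def
  proof (intro conjI ballI, goal_cases)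
    case (4 p) then show ?case using rhs[of "fst p" "snd p"] by (auto simp: G_def split: prod.splits)
  next
    case (5 p) then show ?case using rhs[of "fst p" "snd p"] by (auto simp: G_def split: prod.splits)
  qed (use finP fX[of S] in \<open>auto simp: G_def\<close>)
  have std: "standard_cfg G" using lin by (simp add: standard_cfg_def linear_cfg_def G_def)
  have lang: "cfg_lang G = (\<lambda>w. w \<in> L)"
  proof
    fix w
    have "cfg_lang G w \<longleftrightarrow> lgen R (f S) w"
      unfolding cfg_lang_def using lgen_iff_derives[of G R "f S" w] by (simp add: G_def P_def)
    also have "\<dots> \<longleftrightarrow> lgen R0 S w"
      unfolding R_def using f by (intro lgen_map_states[of f ?X]) (auto simp: bij_betw_def)
    finally show "cfg_lang G w = (w \<in> L)" using 1(4) by simp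
  qed
  have "card (\<Union>(rule_states ` R0)) \<le> (\<Sum>\<rho>\<in>R0. card (rule_states \<rho>))"
    by (rule card_UN_le[OF 1(1)])
  also have "\<dots> \<le> card R0 * 2" using sum_bounded_above[of R0 "\<lambda>\<rho>. card (rule_states \<rho>)" 2, OF rule_states_card] by simp
  also have "\<dots> \<le> r * 2" using 1(2) by simp
  finally have cX: "card ?X \<le> 1 + r * 2"
    using finite_rules_states[OF 1(1)] by (simp add: card_insert_if)
  have "(\<Sum>(A, \<alpha>)\<in>P. 1 + length \<alpha>) \<le> card P * (b + 2)"
    using sum_bounded_above[of P "\<lambda>(A, \<alpha>). 1 + length \<alpha>" "b + 2"] rhs by auto
  also have "\<dots> \<le> r * (b + 2)" using cP by (rule mult_le_mono1)
  finally have "cfg_size G \<le> 3 + r * (b + 4)"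
    using cX by (simp add: cfg_size_def G_def algebra_simps)
  then show ?thesis using lin std lang by blast
qed

section \<open>Languages recognised by automata\<close>

text \<open>One right-linear rule per transition and one stopping rule per rejecting state;
  determinism makes the generated language the complement.\<close>

lemma lin_dfa_compl:
  fixes \<delta> :: "'s \<Rightarrow> 'a \<Rightarrow> 's"
  assumes "finite Q" "finite \<Sigma>" "s0 \<in> Q" and closed: "\<And>s a. s \<in> Q \<Longrightarrow> a \<in> \<Sigma> \<Longrightarrow> \<delta> s a \<in> Q"
  shows "lin 1 (card Q * card \<Sigma> + card Q) {w \<in> lists \<Sigma>. \<not> F (foldl \<delta> s0 w)}"
proof -
  let ?I = "(\<lambda>(s, a). (s, [a], Some (\<delta> s a, []))) ` (Q \<times> \<Sigma>) :: ('s, 'a) lrule set"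
  let ?J = "(\<lambda>s. (s, [], None)) ` {s \<in> Q. \<not> F s} :: ('s, 'a) lrule set"
  let ?R = "?I \<union> ?J"
  have sound: "lgen ?R s w \<Longrightarrow> w \<in> lists \<Sigma> \<and> \<not> F (foldl \<delta> s w)" for s w
    by (induction rule: lgen.induct) auto
  have complete: "w \<in> lists \<Sigma> \<Longrightarrow> s \<in> Q \<Longrightarrow> \<not> F (foldl \<delta> s w) \<Longrightarrow> lgen ?R s w" for s w
  proof (induction w arbitrary: s)
    case Nil
    then show ?case by (intro lgen_stop) auto
  next
    case (Cons a w)
    have "(s, [a], Some (\<delta> s a, [])) \<in> ?R" using Cons.prems by auto
    moreover have "lgen ?R (\<delta> s a) w" by (rule Cons.IH) (use Cons.prems closed in auto)
    ultimately show ?case by (rule lgen_go') simp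
  qed
  have fin: "finite ?R" using assms by simp
  have "card ?I \<le> card (Q \<times> \<Sigma>)" by (rule card_image_le) (use assms in simp)
  moreover have "card ?J \<le> card {s \<in> Q. \<not> F s}" by (rule card_image_le) (use assms in simp)
  moreover have "card {s \<in> Q. \<not> F s} \<le> card Q" by (rule card_mono) (use assms in auto)
  ultimately have card: "card ?R \<le> card Q * card \<Sigma> + card Q"
    using card_Un_le[of ?I ?J] by (simp add: card_cartesian_product)
  have "{w \<in> lists \<Sigma>. \<not> F (foldl \<delta> s0 w)} = {w. lgen ?R s0 w}"
    using sound[of s0] complete[of _ s0] \<open>s0 \<in> Q\<close> by blast
  then show ?thesis by (intro linI[OF fin card]) auto
qed

section \<open>Comparing the two blocks around a separator\<close>

fun pair_accepts :: "('s \<Rightarrow> 'a \<Rightarrow> 'a \<Rightarrow> 's) \<Rightarrow> ('s \<Rightarrow> bool) \<Rightarrow> 's \<Rightarrow> 'a list \<Rightarrow> 'a list \<Rightarrow> bool" where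
  "pair_accepts \<delta> F s [] [] \<longleftrightarrow> F s"
| "pair_accepts \<delta> F s (a # u) (b # v) \<longleftrightarrow> pair_accepts \<delta> F (\<delta> s a b) u v"
| "pair_accepts \<delta> F s _ _ \<longleftrightarrow> False"

text \<open>The conditions on \<alpha> and \<beta> make \<open>u\<close> and \<open>v\<close>
  maximal blocks over \<open>C\<close>. The right block is reversed because linear rules emit
  letters from both ends inwards.\<close>

definition pair_ok :: "'a set \<Rightarrow> 'a \<Rightarrow> ('a list \<Rightarrow> 'a list \<Rightarrow> bool) \<Rightarrow> 'a list \<Rightarrow> bool" where
  "pair_ok C \<sigma> P w \<longleftrightarrow> (\<forall>\<alpha> u v \<beta>. w = \<alpha> @ u @ \<sigma> # v @ \<beta> \<longrightarrow> (\<alpha> = [] \<or> last \<alpha> \<notin> C) \<longrightarrow>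
     (\<beta> = [] \<or> hd \<beta> \<notin> C) \<longrightarrow> u \<in> lists C \<longrightarrow> v \<in> lists C \<longrightarrow> P u (rev v))"

text \<open>The flag of a context state tells whether the context may end here: the letter emitted
  last lies outside \<open>C\<close>, or nothing has been emitted yet.\<close>

datatype 's pair_state = Left_ctx bool | Right_ctx bool | Match 's | Longer_left | Longer_right

text \<open>The grammar guesses one bad separator. It emits the left context, then the right
  context, then the letters of the two blocks in pairs while simulating the automaton. It stops at
  the separator if the simulation rejects, and changes to \<open>Longer_left\<close> or
  \<open>Longer_right\<close> if the lengths differ.\<close>

lemma lin_pair_bad:
  fixes \<delta> :: "'s \<Rightarrow> 'a \<Rightarrow> 'a \<Rightarrow> 's"
  assumes "finite Q" "finite \<Sigma>" "C \<subseteq> \<Sigma>" "\<sigma> \<in> \<Sigma>" "s0 \<in> Q"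
    and closed: "\<And>s a b. s \<in> Q \<Longrightarrow> a \<in> C \<Longrightarrow> b \<in> C \<Longrightarrow> \<delta> s a b \<in> Q"
  shows "\<exists>r. lin 2 r {w \<in> lists \<Sigma>. \<not> pair_ok C \<sigma> (pair_accepts \<delta> F s0) w}"
proof -
  let ?acc = "pair_accepts \<delta> F"
  define R :: "('s pair_state, 'a) lrule set" where "R =
    (\<lambda>(b, a). (Left_ctx b, [a], Some (Left_ctx (a \<notin> C), []))) ` (UNIV \<times> \<Sigma>) \<union>
    {(Left_ctx True, [], Some (Right_ctx True, [])), (Right_ctx True, [], Some (Match s0, []))} \<union>
    (\<lambda>(b, a). (Right_ctx b, [], Some (Right_ctx (a \<notin> C), [a]))) ` (UNIV \<times> \<Sigma>) \<union>
    (\<lambda>(s, a, b). (Match s, [a], Some (Match (\<delta> s a b), [b]))) ` (Q \<times> C \<times> C) \<union>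
    (\<lambda>s. (Match s, [\<sigma>], None)) ` {s \<in> Q. \<not> F s} \<union>
    (\<lambda>(s, a). (Match s, [a], Some (Longer_left, []))) ` (Q \<times> C) \<union>
    (\<lambda>a. (Longer_left, [a], Some (Longer_left, []))) ` C \<union>
    (\<lambda>(s, a). (Match s, [], Some (Longer_right, [a]))) ` (Q \<times> C) \<union>
    (\<lambda>a. (Longer_right, [], Some (Longer_right, [a]))) ` C \<union>
    {(Longer_left, [\<sigma>], None), (Longer_right, [\<sigma>], None)}"
  \<comment> \<open>\<open>M s\<close>, \<open>N b\<close> and \<open>L b\<close> describe the words
    generated from \<open>Match s\<close>, \<open>Right_ctx b\<close> and \<open>Left_ctx b\<close>;
    the flag decides whether the context still to be emitted may be empty.\<close>
  define M where "M s m \<longleftrightarrow> (\<exists>u v. m = u @ \<sigma> # v \<and> u \<in> lists C \<and> v \<in> lists C \<and> \<not> ?acc s u (rev v))" for s m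
  define N where "N b w \<longleftrightarrow> (\<exists>m \<beta>. w = m @ \<beta> \<and> M s0 m \<and> \<beta> \<in> lists \<Sigma> \<and>
     (if \<beta> = [] then b else hd \<beta> \<notin> C))" for b w
  define L where "L b w \<longleftrightarrow> (\<exists>\<alpha> m. w = \<alpha> @ m \<and> N True m \<and> \<alpha> \<in> lists \<Sigma> \<and>
     (if \<alpha> = [] then b else last \<alpha> \<notin> C))" for b w
  have MI: "M s (u @ \<sigma> # v)" if "u \<in> lists C" "v \<in> lists C" "\<not> ?acc s u (rev v)" for s u v
    using that unfolding M_def by blast
  have NI: "N b (m @ \<beta>)" if "M s0 m" "\<beta> \<in> lists \<Sigma>" "if \<beta> = [] then b else hd \<beta> \<notin> C" for b m \<beta>
    using that unfolding N_def by blast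
  have LI: "L b (\<alpha> @ m)" if "N True m" "\<alpha> \<in> lists \<Sigma>" "if \<alpha> = [] then b else last \<alpha> \<notin> C" for b m \<alpha>
    using that unfolding L_def by blast
  have finC: "finite C" using assms finite_subset by blast
  have finR: "finite R" unfolding R_def using assms finC by simp
  have width: "rule_width \<rho> \<le> 2" if "\<rho> \<in> R" for \<rho>
    using that unfolding R_def by auto
  have bad_iff: "w \<in> lists \<Sigma> \<and> \<not> pair_ok C \<sigma> (?acc s0) w \<longleftrightarrow> L True w" for w
  proof
    assume "w \<in> lists \<Sigma> \<and> \<not> pair_ok C \<sigma> (?acc s0) w"
    then obtain \<alpha> u v \<beta> where w: "w = \<alpha> @ u @ \<sigma> # v @ \<beta>" "\<alpha> = [] \<or> last \<alpha> \<notin> C"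
      "\<beta> = [] \<or> hd \<beta> \<notin> C" "u \<in> lists C" "v \<in> lists C" "\<not> ?acc s0 u (rev v)" "w \<in> lists \<Sigma>"
      unfolding pair_ok_def by blast
    have "M s0 (u @ \<sigma> # v)" using w by (intro MI)
    then have "N True ((u @ \<sigma> # v) @ \<beta>)" using w by (intro NI) auto
    then have "L True (\<alpha> @ (u @ \<sigma> # v) @ \<beta>)" using w by (intro LI) auto
    then show "L True w" using w(1) by simp
  next
    assume "L True w"
    then obtain \<alpha> m where 1: "w = \<alpha> @ m" "N True m" "\<alpha> \<in> lists \<Sigma>" "\<alpha> = [] \<or> last \<alpha> \<notin> C"
      unfolding L_def by (auto split: if_splits)
    then obtain m' \<beta> where 2: "m = m' @ \<beta>" "M s0 m'" "\<beta> \<in> lists \<Sigma>" "\<beta> = [] \<or> hd \<beta> \<notin> C"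
      unfolding N_def by (auto split: if_splits)
    then obtain u v where 3: "m' = u @ \<sigma> # v" "u \<in> lists C" "v \<in> lists C" "\<not> ?acc s0 u (rev v)"
      unfolding M_def by blast
    have "w = \<alpha> @ u @ \<sigma> # v @ \<beta>" using 1 2 3 by simp
    then have "\<not> pair_ok C \<sigma> (?acc s0) w" unfolding pair_ok_def using 1 2 3 by blast
    moreover have "u \<in> lists \<Sigma>" "v \<in> lists \<Sigma>" using 3 \<open>C \<subseteq> \<Sigma>\<close> lists_mono by blast+
    ultimately show "w \<in> lists \<Sigma> \<and> \<not> pair_ok C \<sigma> (?acc s0) w"
      using 1 2 3 \<open>\<sigma> \<in> \<Sigma>\<close> by auto
  qed
  have sound: "lgen R A w \<Longrightarrow> case A of Left_ctx b \<Rightarrow> L b w | Right_ctx b \<Rightarrow> N b w | Match s \<Rightarrow> M s w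
    | Longer_left \<Rightarrow> (\<exists>u\<in>lists C. w = u @ [\<sigma>]) | Longer_right \<Rightarrow> (\<exists>v\<in>lists C. w = \<sigma> # v)" for A w
  proof (induction rule: lgen.induct)
    case (lgen_stop A x)
    then consider (1) s where "A = Match s" "x = [\<sigma>]" "\<not> F s" | (2) "A = Longer_left" "x = [\<sigma>]"
      | (3) "A = Longer_right" "x = [\<sigma>]" unfolding R_def by auto
    then show ?case
    proof cases
      case 1
      then show ?thesis using MI[of "[]" "[]" s] by simp
    qed auto
  next
    case (lgen_go A x B y w)
    from lgen_go(1) consider
      (1) b a where "A = Left_ctx b" "B = Left_ctx (a \<notin> C)" "x = [a]" "y = []" "a \<in> \<Sigma>"
    | (2) "A = Left_ctx True" "B = Right_ctx True" "x = []" "y = []"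
    | (3) "A = Right_ctx True" "B = Match s0" "x = []" "y = []"
    | (4) b a where "A = Right_ctx b" "B = Right_ctx (a \<notin> C)" "x = []" "y = [a]" "a \<in> \<Sigma>"
    | (5) s a b where "A = Match s" "B = Match (\<delta> s a b)" "x = [a]" "y = [b]" "a \<in> C" "b \<in> C"
    | (6) s a where "A = Match s" "B = Longer_left" "x = [a]" "y = []" "a \<in> C"
    | (7) a where "A = Longer_left" "B = Longer_left" "x = [a]" "y = []" "a \<in> C"
    | (8) s a where "A = Match s" "B = Longer_right" "x = []" "y = [a]" "a \<in> C"
    | (9) a where "A = Longer_right" "B = Longer_right" "x = []" "y = [a]" "a \<in> C"
      unfolding R_def by auto
    then show ?case
    proof cases
      case 1
      then obtain \<alpha> m where "w = \<alpha> @ m" "N True m" "\<alpha> \<in> lists \<Sigma>" "if \<alpha> = [] then a \<notin> C else last \<alpha> \<notin> C"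
        using lgen_go.IH unfolding L_def by auto
      then have "L b ((a # \<alpha>) @ m)" using 1 by (intro LI) (auto split: if_splits)
      then show ?thesis using 1 \<open>w = \<alpha> @ m\<close> by simp
    next
      case 2
      then show ?thesis using lgen_go.IH LI[of w "[]" True] by simp
    next
      case 3
      then show ?thesis using lgen_go.IH NI[of w "[]" True] by simp
    next
      case 4
      then obtain m \<beta> where "w = m @ \<beta>" "M s0 m" "\<beta> \<in> lists \<Sigma>" "if \<beta> = [] then a \<notin> C else hd \<beta> \<notin> C"
        using lgen_go.IH unfolding N_def by auto
      then have "N b (m @ \<beta> @ [a])" using 4 by (intro NI) (auto split: if_splits)
      then show ?thesis using 4 \<open>w = m @ \<beta>\<close> by simp
    next
      case 5
      then obtain u v where "w = u @ \<sigma> # v" "u \<in> lists C" "v \<in> lists C" "\<not> ?acc (\<delta> s a b) u (rev v)"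
        using lgen_go.IH unfolding M_def by auto
      then have "M s ((a # u) @ \<sigma> # v @ [b])" using 5 by (intro MI) auto
      then show ?thesis using 5 \<open>w = u @ \<sigma> # v\<close> by simp
    next
      case 6
      then obtain u where "w = u @ [\<sigma>]" "u \<in> lists C" using lgen_go.IH by auto
      then have "M s ((a # u) @ \<sigma> # [])" using 6 by (intro MI) auto
      then show ?thesis using 6 \<open>w = u @ [\<sigma>]\<close> by simp
    next
      case 7
      then obtain u where "w = u @ [\<sigma>]" "u \<in> lists C" using lgen_go.IH by auto
      then have "x @ w @ y = (a # u) @ [\<sigma>]" "a # u \<in> lists C" using 7 by simp_all
      then show ?thesis using 7 by auto
    next
      case 8
      then obtain v where "w = \<sigma> # v" "v \<in> lists C" using lgen_go.IH by auto
      then have "M s ([] @ \<sigma> # v @ [a])" using 8 by (intro MI) auto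
      then show ?thesis using 8 \<open>w = \<sigma> # v\<close> by simp
    next
      case 9
      then obtain v where "w = \<sigma> # v" "v \<in> lists C" using lgen_go.IH by auto
      then have "x @ w @ y = \<sigma> # v @ [a]" "v @ [a] \<in> lists C" using 9 by simp_all
      then show ?thesis using 9 by auto
    qed
  qed
  have left: "lgen R Longer_left (u @ [\<sigma>])" if "u \<in> lists C" for u
    using that
  proof (induction u)
    case Nil
    show ?case by (rule lgen_stop) (simp add: R_def)
  next
    case (Cons a u)
    show ?case
      by (rule lgen_go'[where x = "[a]" and y = "[]" and B = Longer_left and w = "u @ [\<sigma>]"])
        (use Cons in \<open>auto simp: R_def\<close>)
  qed
  have right: "lgen R Longer_right (\<sigma> # v)" if "v \<in> lists C" for v
    using that
  proof (induction v rule: rev_induct)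
    case Nil
    show ?case by (rule lgen_stop) (simp add: R_def)
  next
    case (snoc a v)
    show ?case
      by (rule lgen_go'[where x = "[]" and y = "[a]" and B = Longer_right and w = "\<sigma> # v"])
        (use snoc in \<open>auto simp: R_def\<close>)
  qed
  have match: "lgen R (Match s) (u @ \<sigma> # rev v)"
    if "s \<in> Q" "u \<in> lists C" "v \<in> lists C" "\<not> ?acc s u v" for s u v
    using that
  proof (induction u v arbitrary: s rule: list_induct2')
    case 1
    then show ?case by (intro lgen_stop) (auto simp: R_def)
  next
    case (2 a u)
    then have "lgen R Longer_left (u @ [\<sigma>])" by (intro left) simp
    then show ?case
      by (rule lgen_go'[where x = "[a]" and y = "[]" and B = Longer_left and w = "u @ [\<sigma>]", rotated])
        (use 2 in \<open>auto simp: R_def\<close>)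
  next
    case (3 b v)
    then have "lgen R Longer_right (\<sigma> # rev v)" by (intro right) (simp add: in_lists_conv_set)
    then show ?case
      by (rule lgen_go'[where x = "[]" and y = "[b]" and B = Longer_right and w = "\<sigma> # rev v", rotated])
        (use 3 in \<open>auto simp: R_def\<close>)
  next
    case (4 a u b v)
    have rest: "lgen R (Match (\<delta> s a b)) (u @ \<sigma> # rev v)"
      by (rule "4.IH") (use "4.prems" closed in auto)
    have "(Match s, [a], Some (Match (\<delta> s a b), [b]))
        \<in> (\<lambda>(s, a, b). (Match s, [a], Some (Match (\<delta> s a b), [b]))) ` (Q \<times> C \<times> C)"
      by (rule image_eqI[of _ _ "(s, a, b)"]) (use "4.prems" in auto)
    then have "(Match s, [a], Some (Match (\<delta> s a b), [b])) \<in> R"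
      by (simp only: R_def Un_iff simp_thms)
    from lgen_go[OF this rest] show ?case by simp
  qed
  have matchM: "lgen R (Match s0) m" if "M s0 m" for m
  proof -
    from that obtain u v where "m = u @ \<sigma> # v" "u \<in> lists C" "v \<in> lists C" "\<not> ?acc s0 u (rev v)"
      unfolding M_def by blast
    then show ?thesis using match[of s0 u "rev v"] \<open>s0 \<in> Q\<close> by (simp add: in_lists_conv_set)
  qed
  have rctx: "lgen R (Right_ctx b) (m @ \<beta>)"
    if "M s0 m" "\<beta> \<in> lists \<Sigma>" "if \<beta> = [] then b else hd \<beta> \<notin> C" for b m \<beta>
    using that(2,3)
  proof (induction \<beta> arbitrary: b rule: rev_induct)
    case Nil
    then show ?case
      by (intro lgen_go'[OF _ matchM[OF that(1)], where x = "[]" and y = "[]"]) (auto simp: R_def)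
  next
    case (snoc a \<beta>)
    have rest: "lgen R (Right_ctx (a \<notin> C)) (m @ \<beta>)"
      by (rule snoc.IH) (use snoc.prems in \<open>auto split: if_splits\<close>)
    have "(Right_ctx b, [], Some (Right_ctx (a \<notin> C), [a]))
        \<in> (\<lambda>(b, a). (Right_ctx b, [], Some (Right_ctx (a \<notin> C), [a]))) ` (UNIV \<times> \<Sigma>)"
      by (rule image_eqI[of _ _ "(b, a)"]) (use snoc.prems in auto)
    then have "(Right_ctx b, [], Some (Right_ctx (a \<notin> C), [a])) \<in> R"
      by (rule subsetD[rotated]) (auto simp only: R_def Un_iff)
    from lgen_go[OF this rest] show ?case by simp
  qed
  have lctx: "lgen R (Left_ctx b) (\<alpha> @ m)"
    if "lgen R (Right_ctx True) m" "\<alpha> \<in> lists \<Sigma>" "if \<alpha> = [] then b else last \<alpha> \<notin> C" for b \<alpha> m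
    using that(2,3)
  proof (induction \<alpha> arbitrary: b rule: list.induct)
    case Nil
    then show ?case
      by (intro lgen_go'[OF _ that(1), where x = "[]" and y = "[]"]) (auto simp: R_def)
  next
    case (Cons a \<alpha>)
    have rest: "lgen R (Left_ctx (a \<notin> C)) (\<alpha> @ m)"
      by (rule Cons.IH) (use Cons.prems in \<open>auto split: if_splits\<close>)
    have "(Left_ctx b, [a], Some (Left_ctx (a \<notin> C), []))
        \<in> (\<lambda>(b, a). (Left_ctx b, [a], Some (Left_ctx (a \<notin> C), []))) ` (UNIV \<times> \<Sigma>)"
      by (rule image_eqI[of _ _ "(b, a)"]) (use Cons.prems(1) in auto)
    then have "(Left_ctx b, [a], Some (Left_ctx (a \<notin> C), [])) \<in> R"
      by (rule subsetD[rotated]) (auto simp only: R_def Un_iff)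
    from lgen_go[OF this rest] show ?case by simp
  qed
  have "lgen R (Left_ctx True) w" if "L True w" for w
    using that rctx lctx unfolding L_def N_def by blast
  then have "{w \<in> lists \<Sigma>. \<not> pair_ok C \<sigma> (?acc s0) w} = {w. lgen R (Left_ctx True) w}"
    using bad_iff sound[of "Left_ctx True"] by auto
  then show ?thesis using linI[OF finR order_refl width] by blast
qed

section \<open>Peeling off the first block of a word\<close>

lemma split_first_sep:
  assumes "u \<in> lists C" "u' \<in> lists C" "s \<notin> C" "s' \<notin> C" "u @ s # x = u' @ s' # x'"
  shows "u = u' \<and> s = s' \<and> x = x'"
  using assms
proof (induction u arbitrary: u' rule: list.induct)
  case Nil
  then show ?case by (cases u') auto
next
  case (Cons a u)
  then show ?case by (cases u') auto
qed

lemma pair_ok_cells: "u \<in> lists C \<Longrightarrow> \<sigma> \<notin> C \<Longrightarrow> pair_ok C \<sigma> P u"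
  by (auto simp: pair_ok_def)

text \<open>A block is the right neighbour of one separator and the left neighbour of the next, so
  \<open>v\<close> has to stay when \<open>u\<close> and \<open>s\<close> are removed. An occurrence
  in the long word concerns the first separator if \<alpha> is empty; otherwise it lies entirely in
  the shorter word.\<close>

lemma pair_ok_sep:
  assumes uv: "u \<in> lists C" "v \<in> lists C" and s: "s \<notin> C" "\<sigma> \<notin> C" and \<beta>: "\<beta> = [] \<or> hd \<beta> \<notin> C"
  shows "pair_ok C \<sigma> P (u @ s # v @ \<beta>) \<longleftrightarrow> (s = \<sigma> \<longrightarrow> P u (rev v)) \<and> pair_ok C \<sigma> P (v @ \<beta>)"
proof (intro iffI conjI impI)
  assume *: "pair_ok C \<sigma> P (u @ s # v @ \<beta>)"
  show "P u (rev v)" if "s = \<sigma>"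
    using *[unfolded pair_ok_def, rule_format, of "[]" u v \<beta>] uv \<beta> that by simp
  show "pair_ok C \<sigma> P (v @ \<beta>)" unfolding pair_ok_def
  proof (intro allI impI)
    fix \<alpha> u' v' \<beta>' assume "v @ \<beta> = \<alpha> @ u' @ \<sigma> # v' @ \<beta>'" "\<alpha> = [] \<or> last \<alpha> \<notin> C"
      "\<beta>' = [] \<or> hd \<beta>' \<notin> C" "u' \<in> lists C" "v' \<in> lists C"
    then show "P u' (rev v')"
      using *[unfolded pair_ok_def, rule_format, of "u @ s # \<alpha>" u' v' \<beta>'] s by (auto split: if_splits)
  qed
next
  assume *: "(s = \<sigma> \<longrightarrow> P u (rev v)) \<and> pair_ok C \<sigma> P (v @ \<beta>)"
  show "pair_ok C \<sigma> P (u @ s # v @ \<beta>)" unfolding pair_ok_def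
  proof (intro allI impI)
    fix \<alpha> u' v' \<beta>' assume w: "u @ s # v @ \<beta> = \<alpha> @ u' @ \<sigma> # v' @ \<beta>'" "\<alpha> = [] \<or> last \<alpha> \<notin> C"
      "\<beta>' = [] \<or> hd \<beta>' \<notin> C" "u' \<in> lists C" "v' \<in> lists C"
    show "P u' (rev v')"
    proof (cases "\<alpha> = []")
      case True
      then have e: "u = u'" "s = \<sigma>" "v @ \<beta> = v' @ \<beta>'"
        using split_first_sep[of u C u' s \<sigma> "v @ \<beta>" "v' @ \<beta>'"] uv s w by auto
      have "v = takeWhile (\<lambda>a. a \<in> C) (v @ \<beta>)" "v' = takeWhile (\<lambda>a. a \<in> C) (v' @ \<beta>')"
        using uv w(3,5) \<beta> by (auto simp: takeWhile_append takeWhile_eq_Nil_iff)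
      then have "v = v'" using e(3) by simp
      then show ?thesis using e * by simp
    next
      case False
      \<comment> \<open>A nonempty \<alpha> ends outside \<open>C\<close>; its first letter outside
        \<open>C\<close> must be the separator \<open>s\<close>.\<close>
      then have "last \<alpha> \<in> set \<alpha>" "last \<alpha> \<notin> C" using w(2) by auto
      then obtain a b c where abc: "\<alpha> = a @ b # c" "b \<notin> C" "\<forall>y\<in>set a. y \<in> C"
        using split_list_first_prop[of \<alpha> "\<lambda>x. x \<notin> C"] by blast
      then have "u = a \<and> s = b \<and> v @ \<beta> = c @ u' @ \<sigma> # v' @ \<beta>'"
        using split_first_sep[of u C a s b "v @ \<beta>" "c @ u' @ \<sigma> # v' @ \<beta>'"] uv s w(1)
        by (auto simp: in_lists_conv_set)
      moreover have "c = [] \<or> last c \<notin> C" using w(2) abc by (auto split: if_splits)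
      ultimately show ?thesis
        using *[THEN conjunct2, unfolded pair_ok_def, rule_format, of c u' v' \<beta>'] w by blast
    qed
  qed
qed

section \<open>A binary code\<close>

text \<open>A prefix code without empty code words: decoding is unique, and lower bounds on the
  length of a word survive the encoding.\<close>

definition unary_code :: "('a \<Rightarrow> nat) \<Rightarrow> 'a list \<Rightarrow> bool list" where
  "unary_code f w = concat (map (\<lambda>a. replicate (f a) True @ [False]) w)"

lemma unary_code_simps [simp]:
  "unary_code f [] = []"
  "unary_code f (a # w) = replicate (f a) True @ False # unary_code f w"
  by (simp_all add: unary_code_def)

lemma length_unary_code: "length w \<le> length (unary_code f w)"
  by (induction w) auto

lemma replicate_True_split:
  "replicate i True @ False # x = replicate j True @ False # y \<Longrightarrow> i = j \<and> x = y"
proof (induction i arbitrary: j)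
  case 0
  then show ?case by (cases j) auto
next
  case (Suc i)
  then show ?case by (cases j) auto
qed

lemma unary_code_inj:
  assumes "inj_on f \<Sigma>" "v \<in> lists \<Sigma>" "w \<in> lists \<Sigma>" "unary_code f v = unary_code f w"
  shows "v = w"
  using assms(2-)
proof (induction v arbitrary: w rule: list.induct)
  case Nil
  then show ?case by (cases w) auto
next
  case (Cons a v)
  then obtain b w' where w: "w = b # w'" by (cases w) auto
  then have "replicate (f a) True @ False # unary_code f v = replicate (f b) True @ False # unary_code f w'"
    using Cons.prems by simp
  from replicate_True_split[OF this] have "f a = f b" "unary_code f v = unary_code f w'" by auto
  then show ?case using Cons w assms(1) by (auto dest: inj_onD)
qed

text \<open>A state below \<open>k\<close> counts the letters \<open>True\<close> since the last
  \<open>False\<close>; \<open>k\<close> is a dead state, since code words contain fewer than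
  \<open>k\<close> letters \<open>True\<close>.\<close>

definition code_step :: "nat \<Rightarrow> nat \<Rightarrow> bool \<Rightarrow> nat" where
  "code_step k i b = (if i = k then k else if b then Suc i else 0)"

lemma code_step_dead: "foldl (code_step k) k x = k"
  by (induction x) (auto simp: code_step_def)

text \<open>Starting in state \<open>i\<close> amounts to having already read \<open>i\<close>
  letters \<open>True\<close>; this form carries the induction.\<close>

lemma code_step_iff:
  assumes "f ` \<Sigma> = {..<k}" "i < k"
  shows "foldl (code_step k) i x = 0 \<longleftrightarrow> replicate i True @ x \<in> unary_code f ` lists \<Sigma>"
  using \<open>i < k\<close>
proof (induction x arbitrary: i)
  case Nil
  have "replicate i True \<noteq> unary_code f w" if "i > 0" for w
  proof (cases w)
    case (Cons a w')
    have "False \<notin> set (replicate i True)" by simp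
    then show ?thesis using Cons by (metis in_set_conv_decomp unary_code_simps(2))
  qed (use that in simp)
  then show ?case by (auto simp: image_iff intro: bexI[of _ "[]"])
next
  case (Cons b x)
  show ?case
  proof (cases b)
    case False
    have "foldl (code_step k) i (b # x) = foldl (code_step k) 0 x"
      using False Cons.prems by (simp add: code_step_def)
    also have "\<dots> = 0 \<longleftrightarrow> x \<in> unary_code f ` lists \<Sigma>" using Cons.IH[of 0] Cons.prems by simp
    also have "\<dots> \<longleftrightarrow> replicate i True @ False # x \<in> unary_code f ` lists \<Sigma>"
    proof
      assume "x \<in> unary_code f ` lists \<Sigma>"
      then obtain w where w: "w \<in> lists \<Sigma>" "x = unary_code f w" by blast
      obtain a where a: "a \<in> \<Sigma>" "f a = i" using assms(1) Cons.prems by (metis imageE lessThan_iff)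
      show "replicate i True @ False # x \<in> unary_code f ` lists \<Sigma>"
        by (rule image_eqI[of _ _ "a # w"]) (use a w in auto)
    next
      assume "replicate i True @ False # x \<in> unary_code f ` lists \<Sigma>"
      then obtain w where w: "w \<in> lists \<Sigma>" "replicate i True @ False # x = unary_code f w" by blast
      then obtain a w' where "w = a # w'" by (cases w) auto
      then show "x \<in> unary_code f ` lists \<Sigma>"
        using w replicate_True_split[of i x "f a" "unary_code f w'"] by auto
    qed
    finally show ?thesis using False by simp
  next
    case True
    show ?thesis
    proof (cases "Suc i = k")
      case dead: True
      have "replicate k True @ x \<noteq> unary_code f w" if "w \<in> lists \<Sigma>" for w
      proof (cases w)
        case Nil
        then show ?thesis using Cons.prems by simp
      next
        case (Cons a w')
        then have "f a < k" using that assms(1) by auto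
        then have "unary_code f w ! f a = False" "(replicate k True @ x) ! f a = True"
          using Cons by (simp_all add: nth_append)
        then show ?thesis by metis
      qed
      then have notin: "replicate k True @ x \<notin> unary_code f ` lists \<Sigma>" by blast
      have rep: "replicate i True @ b # x = replicate k True @ x"
        using True by (simp add: replicate_app_Cons_same flip: dead)
      have dead_step: "foldl (code_step k) i (b # x) = k"
        using True dead Cons.prems by (simp add: code_step_def code_step_dead)
      show ?thesis unfolding rep dead_step using notin Cons.prems by simp
    next
      case False
      have rep: "replicate i True @ b # x = replicate (Suc i) True @ x"
        using True by (simp add: replicate_app_Cons_same)
      have live_step: "foldl (code_step k) i (b # x) = foldl (code_step k) (Suc i) x"
        using True Cons.prems by (simp add: code_step_def)
      show ?thesis unfolding rep live_step using Cons.IH[of "Suc i"] Cons.prems False by simp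
    qed
  qed
qed

text \<open>A bit string outside the image of \<open>L\<close> either encodes nothing or encodes a
  word outside \<open>L\<close>, by injectivity. The code and the constants are chosen before
  \<open>L\<close>, so they will not depend on \<open>n\<close>.\<close>

lemma lin_binary_compl:
  assumes "finite \<Sigma>" "\<Sigma> \<noteq> {}"
  shows "\<exists>(e :: 'a list \<Rightarrow> bool list) k r'. (\<forall>w. length w \<le> length (e w)) \<and>
    (\<forall>L b r. L \<subseteq> lists \<Sigma> \<longrightarrow> lin b r (lists \<Sigma> - L) \<longrightarrow> lin (k * b + 1) (r + r') (- e ` L))"
proof -
  let ?k = "card \<Sigma>"
  obtain f0 :: "'a \<Rightarrow> nat" where f0: "bij_betw f0 \<Sigma> {..<?k}"
    using ex_bij_betw_finite_nat[OF assms(1)] by (auto simp: atLeast0LessThan)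
  \<comment> \<open>The value 0 outside \<open>\<Sigma>\<close> keeps all code words within length
    \<open>card \<Sigma>\<close>, as \<open>lin_concat_map\<close> demands for every letter of the
    type.\<close>
  define f where "f a = (if a \<in> \<Sigma> then f0 a else 0)" for a
  have k: "0 < ?k" using assms by (simp add: card_gt_0_iff)
  have inj: "inj_on f \<Sigma>" and img: "f ` \<Sigma> = {..<?k}"
    using f0 by (auto simp: bij_betw_def f_def inj_on_def)
  have f_less: "f a < ?k" for a using img k by (cases "a \<in> \<Sigma>") (auto simp: f_def)
  let ?Q = "{..?k}"
  have "lin 1 (card ?Q * card (UNIV :: bool set) + card ?Q) {x \<in> lists UNIV. \<not> foldl (code_step ?k) 0 x = 0}"
    by (rule lin_dfa_compl) (auto simp: code_step_def)
  moreover have "{x \<in> lists UNIV. \<not> foldl (code_step ?k) 0 x = 0} = - unary_code f ` lists \<Sigma>"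
    using code_step_iff[OF img k] by auto
  ultimately have "lin 1 (card ?Q * card (UNIV :: bool set) + card ?Q) (- unary_code f ` lists \<Sigma>)"
    by (simp only:)
  then have noncode: "lin 1 (3 * (?k + 1)) (- unary_code f ` lists \<Sigma>)"
    by (rule lin_mono) simp_all
  have "lin ((?k + 1) * b + 1) (r + (3 * (?k + 1) + 2)) (- unary_code f ` L)"
    if L: "L \<subseteq> lists \<Sigma>" "lin b r (lists \<Sigma> - L)" for L b r
  proof -
    have "lin (?k * b) r ((\<lambda>w. concat (map (\<lambda>a. replicate (f a) True @ [False]) w)) ` (lists \<Sigma> - L))"
      by (rule lin_concat_map[OF L(2)]) (use f_less in \<open>simp add: Suc_le_eq\<close>)
    then have "lin (?k * b) r (unary_code f ` (lists \<Sigma> - L))"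
      by (simp add: unary_code_def[abs_def])
    \<comment> \<open>Both parts of the union need a common width; the summand 1 covers the width 1
      of \<open>noncode\<close> when \<open>b = 0\<close>.\<close>
    then have "lin ((?k + 1) * b + 1) r (unary_code f ` (lists \<Sigma> - L))"
      by (rule lin_mono) (simp_all add: algebra_simps)
    from lin_Un[OF this lin_mono[OF noncode, of "(?k + 1) * b + 1" "3 * (?k + 1)"]]
    have "lin ((?k + 1) * b + 1) (r + 3 * (?k + 1) + 2)
      (unary_code f ` (lists \<Sigma> - L) \<union> - unary_code f ` lists \<Sigma>)" by simp
    moreover have "unary_code f ` (lists \<Sigma> - L) \<union> - unary_code f ` lists \<Sigma> = - unary_code f ` L"
      using L(1) unary_code_inj[OF inj] by blast
    ultimately show ?thesis by (simp add: algebra_simps)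
  qed
  then show ?thesis using length_unary_code by blast
qed

section \<open>Rows and their relations\<close>

text \<open>In \<open>Cell m h a\<close>, \<open>m\<close> is the mark and \<open>a\<close> the tape
  symbol; \<open>h\<close> is 0 away from the head and \<open>Suc q\<close> where the head scans in
  state \<open>q\<close>.\<close>

datatype letter = Cell nat nat nat | Step_sep | Restart_sep | Link_sep

fun mark :: "letter \<Rightarrow> nat" where
  "mark (Cell m h a) = m"
| "mark _ = 0"

fun halting :: "tm \<Rightarrow> letter \<Rightarrow> bool" where
  "halting M (Cell m (Suc q) a) \<longleftrightarrow> tm_delta M q a = None"
| "halting M _ \<longleftrightarrow> False"

definition cells :: "tm \<Rightarrow> letter set" where
  "cells M = {Cell m h a | m h a. m < 3 \<and> h \<le> tm_states M \<and> a < tm_syms M}"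

definition letters :: "tm \<Rightarrow> letter set" where
  "letters M = cells M \<union> {Step_sep, Restart_sep, Link_sep}"

lemma finite_cells: "finite (cells M)"
proof -
  have "cells M \<subseteq> (\<lambda>(m, h, a). Cell m h a) ` ({..<3} \<times> {..tm_states M} \<times> {..<tm_syms M})"
    by (auto simp: cells_def image_iff)
  then show ?thesis by (rule finite_subset) simp
qed

lemma finite_letters: "finite (letters M)"
  by (simp add: letters_def finite_cells)

lemma sep_notin_cells [simp]: "Step_sep \<notin> cells M" "Restart_sep \<notin> cells M" "Link_sep \<notin> cells M"
  by (auto simp: cells_def)

lemma Cell_in_cells [simp]:
  "Cell m h a \<in> cells M \<longleftrightarrow> m < 3 \<and> h \<le> tm_states M \<and> a < tm_syms M"
  by (simp add: cells_def)

fun plain_row :: "nat list \<Rightarrow> nat list \<Rightarrow> letter list" where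
  "plain_row (m # ms) (a # y) = Cell m 0 a # plain_row ms y"
| "plain_row _ _ = []"

text \<open>The list \<open>x\<close> is in tape order, the reverse of the left part of a
  configuration. The head is on the first cell of \<open>y\<close>, which must be nonempty for a
  proper row.\<close>

fun row :: "nat list \<Rightarrow> nat \<Rightarrow> nat list \<Rightarrow> nat list \<Rightarrow> letter list" where
  "row (m # ms) q (a # x) y = Cell m 0 a # row ms q x y"
| "row (m # ms) q [] (a # y) = Cell m (Suc q) a # plain_row ms y"
| "row _ _ _ _ = []"

lemma mark_plain_row: "length ms = length y \<Longrightarrow> map mark (plain_row ms y) = ms"
  by (induction ms y rule: plain_row.induct) auto

lemma mark_row: "length ms = length x + length y \<Longrightarrow> y \<noteq> [] \<Longrightarrow> map mark (row ms q x y) = ms"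
  by (induction ms q x y rule: row.induct) (auto simp: mark_plain_row)

lemma length_row: "length ms = length x + length y \<Longrightarrow> y \<noteq> [] \<Longrightarrow> length (row ms q x y) = length ms"
  by (metis length_map mark_row)

lemma halting_plain_row: "c \<in> set (plain_row ms y) \<Longrightarrow> \<not> halting M c"
  by (induction ms y rule: plain_row.induct) auto

lemma halting_row: "length ms = length x + length y \<Longrightarrow> y \<noteq> [] \<Longrightarrow>
    (\<exists>c\<in>set (row ms q x y). halting M c) \<longleftrightarrow> tm_delta M q (scan y) = None"
  by (induction ms q x y rule: row.induct) (auto simp: scan_def halting_plain_row)

lemma plain_row_in_cells:
  "set ms \<subseteq> {..<3} \<Longrightarrow> set y \<subseteq> {..<tm_syms M} \<Longrightarrow> plain_row ms y \<in> lists (cells M)"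
  by (induction ms y rule: plain_row.induct) auto

lemma row_in_cells:
  "set ms \<subseteq> {..<3} \<Longrightarrow> q < tm_states M \<Longrightarrow> set x \<union> set y \<subseteq> {..<tm_syms M} \<Longrightarrow>
    row ms q x y \<in> lists (cells M)"
  by (induction ms q x y rule: row.induct) (use plain_row_in_cells in \<open>auto simp del: in_lists_conv_set\<close>)

subsection \<open>One machine step\<close>

text \<open>Only steps that stay within the segment: a left move needs a cell before the head, a
  right move a cell behind it. This keeps the length constant.\<close>

inductive row_step :: "tm \<Rightarrow> nat \<times> nat list \<times> nat list \<Rightarrow> nat \<times> nat list \<times> nat list \<Rightarrow> bool" for M where
  row_stay: "tm_delta M q a = Some (q', b, MStay) \<Longrightarrow> row_step M (q, x, a # y) (q', x, b # y)"
| row_left: "tm_delta M q a = Some (q', b, MLeft) \<Longrightarrow> row_step M (q, x @ [c], a # y) (q', x, c # b # y)"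
| row_right: "tm_delta M q a = Some (q', b, MRight) \<Longrightarrow> row_step M (q, x, a # c # y) (q', x @ [b], c # y)"

lemma row_step_tm_step:
  "row_step M (q, x, y) (q', x', y') \<Longrightarrow> tm_step M (q, rev x, y) = Some (q', rev x', y')"
  by (erule row_step.cases) (auto simp: scan_def)

lemma row_step_length: "row_step M (q, x, y) (q', x', y') \<Longrightarrow>
    y \<noteq> [] \<and> y' \<noteq> [] \<and> length x' + length y' = length x + length y"
  by (erule row_step.cases) auto

lemma row_step_Cons: "row_step M (q, x, y) (q', x', y') \<Longrightarrow> row_step M (q, c # x, y) (q', c # x', y')"
proof (erule row_step.cases, goal_cases)
  case 1 then show ?case using row_stay by auto
next
  case (2 q a q' b x d y)
  then show ?case using row_left[of M q a q' b "c # x" d y] by auto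
next
  case (3 q a q' b x d y)
  then show ?case using row_right[of M q a q' b "c # x" d y] by auto
qed

text \<open>
  \<open>Expect_old q\<close> is entered when the head has been found in state \<open>q\<close> in the second row and is
  expected at the next cell of the first row; \<open>Expect_new q\<close> is entered in the opposite case.
\<close>

datatype step_state = Before | Expect_old nat | Expect_new nat | After | Fail

fun step_dfa :: "tm \<Rightarrow> step_state \<Rightarrow> letter \<Rightarrow> letter \<Rightarrow> step_state" where
  "step_dfa M Before (Cell m 0 a) (Cell m' 0 a') = (if m = m' \<and> a = a' then Before else Fail)"
| "step_dfa M Before (Cell m 0 a) (Cell m' (Suc q') a') =
     (if m = m' \<and> a = a' then Expect_old q' else Fail)"
| "step_dfa M Before (Cell m (Suc q) a) (Cell m' 0 a') =
     (case tm_delta M q a of Some (q', b, MRight) \<Rightarrow> if m = m' \<and> a' = b then Expect_new q' else Fail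
      | _ \<Rightarrow> Fail)"
| "step_dfa M Before (Cell m (Suc q) a) (Cell m' (Suc q') a') =
     (if m = m' \<and> tm_delta M q a = Some (q', a', MStay) then After else Fail)"
| "step_dfa M (Expect_old q') (Cell m (Suc q) a) (Cell m' 0 a') =
     (if m = m' \<and> tm_delta M q a = Some (q', a', MLeft) then After else Fail)"
| "step_dfa M (Expect_new q') (Cell m 0 a) (Cell m' (Suc q) a') =
     (if m = m' \<and> a = a' \<and> q = q' then After else Fail)"
| "step_dfa M After (Cell m 0 a) (Cell m' 0 a') = (if m = m' \<and> a = a' then After else Fail)"
| "step_dfa M _ _ _ = Fail"

abbreviation "step_accepts M \<equiv> pair_accepts (step_dfa M) (\<lambda>s. s = After)"

lemma step_Fail: "\<not> step_accepts M Fail u v"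
  by (induction u v rule: list_induct2') auto

lemma pair_accepts_Cons: "pair_accepts \<delta> F s (a # u) v \<longleftrightarrow>
    (\<exists>b v'. v = b # v' \<and> pair_accepts \<delta> F (\<delta> s a b) u v')"
  by (cases v) auto

lemma pair_accepts_Nil: "pair_accepts \<delta> F s [] v \<longleftrightarrow> v = [] \<and> F s"
  by (cases v) auto

lemma step_After: "length ms = length y \<Longrightarrow>
    step_accepts M After (plain_row ms y) v \<longleftrightarrow> v = plain_row ms y"
proof (induction ms y arbitrary: v rule: plain_row.induct)
  case (1 m ms a y)
  have "step_accepts M (step_dfa M After (Cell m 0 a) b) (plain_row ms y) v' \<longleftrightarrow>
      b = Cell m 0 a \<and> v' = plain_row ms y" for b v'
  proof (cases "b = Cell m 0 a")
    case False
    then have "step_dfa M After (Cell m 0 a) b = Fail"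
      by (cases "(M, After, Cell m 0 a, b)" rule: step_dfa.cases) auto
    then show ?thesis using False step_Fail by simp
  qed (use 1 in simp)
  then show ?case by (auto simp: pair_accepts_Cons)
qed (auto simp: pair_accepts_Nil)

text \<open>Nothing is assumed about the shape of \<open>v\<close>: comparison with a proper row
  forces it to be a proper row with the same marks. So along a chain the shape needs to be tested
  for the first row only.\<close>

lemma step_sound:
  "length ms = length x + length y \<Longrightarrow> y \<noteq> [] \<Longrightarrow> step_accepts M Before (row ms q x y) v \<Longrightarrow>
    \<exists>q' x' y'. v = row ms q' x' y' \<and> row_step M (q, x, y) (q', x', y')"
proof (induction x arbitrary: ms v)
  case Nil
  then obtain m ms' a y' where 1: "ms = m # ms'" "y = a # y'" "length ms' = length y'"
    by (cases ms; cases y) auto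
  then obtain b v' where v: "v = b # v'"
    "step_accepts M (step_dfa M Before (Cell m (Suc q) a) b) (plain_row ms' y') v'"
    using Nil.prems(3) by (auto simp: pair_accepts_Cons)
  have "step_dfa M Before (Cell m (Suc q) a) b \<noteq> Fail" using v(2) step_Fail by metis
  then consider (stay) q' c where "b = Cell m (Suc q') c" "tm_delta M q a = Some (q', c, MStay)"
    | (right) q' c where "b = Cell m 0 c" "tm_delta M q a = Some (q', c, MRight)"
    by (cases "(M, Before, Cell m (Suc q) a, b)" rule: step_dfa.cases)
      (auto split: option.splits if_splits move.splits)
  then show ?case
  proof cases
    case stay
    then have "v = row ms q' [] (c # y')" using v 1 step_After[of ms' y' M v'] by simp
    then show ?thesis using row_stay[OF stay(2), of "[]" y'] 1
      by (intro exI[of _ q'] exI[of _ "[]"] exI[of _ "c # y'"]) simp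
  next
    case right
    then have *: "step_accepts M (Expect_new q') (plain_row ms' y') v'" using v by simp
    then obtain m' ms'' d y'' where 2: "ms' = m' # ms''" "y' = d # y''" "length ms'' = length y''"
      using 1(3) by (cases ms'; cases y') (auto simp: pair_accepts_Nil)
    then obtain b' v'' where v': "v' = b' # v''"
      "step_accepts M (step_dfa M (Expect_new q') (Cell m' 0 d) b') (plain_row ms'' y'') v''"
      using * by (auto simp: pair_accepts_Cons)
    have "step_dfa M (Expect_new q') (Cell m' 0 d) b' \<noteq> Fail" using v'(2) step_Fail by metis
    then have b': "b' = Cell m' (Suc q') d"
      by (cases "(M, Expect_new q', Cell m' 0 d, b')" rule: step_dfa.cases) (auto split: if_splits)
    then have "v = row ms q' ([] @ [c]) (d # y'')"
      using v v' 1 2 right step_After[of ms'' y'' M v''] by simp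
    then show ?thesis using row_right[OF right(2), of "[]" d y''] 1 2 by blast
  qed
next
  case (Cons a x)
  then obtain m ms' where 1: "ms = m # ms'" "length ms' = length x + length y"
    by (cases ms) auto
  then obtain b v' where v: "v = b # v'"
    "step_accepts M (step_dfa M Before (Cell m 0 a) b) (row ms' q x y) v'"
    using Cons.prems(3) by (auto simp: pair_accepts_Cons)
  have "step_dfa M Before (Cell m 0 a) b \<noteq> Fail" using v(2) step_Fail by metis
  then consider (plain) "b = Cell m 0 a" | (head) q' where "b = Cell m (Suc q') a"
    by (cases "(M, Before, Cell m 0 a, b)" rule: step_dfa.cases) (auto split: if_splits)
  then show ?case
  proof cases
    case plain
    then have "step_accepts M Before (row ms' q x y) v'" using v by simp
    then obtain q' x' y' where "v' = row ms' q' x' y'" "row_step M (q, x, y) (q', x', y')"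
      using Cons.IH[OF 1(2) Cons.prems(2)] by blast
    then show ?thesis using plain 1 v row_step_Cons
      by (intro exI[of _ q'] exI[of _ "a # x'"] exI[of _ y']) auto
  next
    case head
    then have *: "step_accepts M (Expect_old q') (row ms' q x y) v'" using v by simp
    obtain d y'' where y: "y = d # y''" using Cons.prems(2) by (cases y) auto
    obtain m' ms'' where 2: "ms' = m' # ms''" using 1(2) y by (cases ms') auto
    \<comment> \<open>The new head was found one cell earlier, so the old head must be on the very
      next cell.\<close>
    have "x = []"
    proof (rule ccontr)
      assume "x \<noteq> []"
      then obtain e x'' where "x = e # x''" by (cases x) auto
      then obtain b' v'' where "step_accepts M (step_dfa M (Expect_old q') (Cell m' 0 e) b') (row ms'' q x'' y) v''"
        using * 2 by (auto simp: pair_accepts_Cons)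
      moreover have "step_dfa M (Expect_old q') (Cell m' 0 e) b' = Fail"
        by (cases "(M, Expect_old q', Cell m' 0 e, b')" rule: step_dfa.cases) auto
      ultimately show False using step_Fail by metis
    qed
    then obtain b' v'' where v': "v' = b' # v''"
      "step_accepts M (step_dfa M (Expect_old q') (Cell m' (Suc q) d) b') (plain_row ms'' y'') v''"
      using * 2 y by (auto simp: pair_accepts_Cons)
    have "step_dfa M (Expect_old q') (Cell m' (Suc q) d) b' \<noteq> Fail" using v'(2) step_Fail by metis
    then obtain c where b': "b' = Cell m' 0 c" "tm_delta M q d = Some (q', c, MLeft)"
      by (cases "(M, Expect_old q', Cell m' (Suc q) d, b')" rule: step_dfa.cases) (auto split: if_splits)
    then have "v = row ms q' [] (a # c # y'')"
      using v v' 1 2 y head \<open>x = []\<close> step_After[of ms'' y'' M v''] by simp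
    then show ?thesis using row_left[OF b'(2), of "[]" a y''] y \<open>x = []\<close> by auto
  qed
qed

text \<open>To the left of the cells affected both rows agree, so \<open>prefix\<close> reduces the
  claim to the one or two cells around the head; behind them \<open>step_After\<close>
  applies.\<close>

lemma step_complete:
  assumes "row_step M (q, x, y) (q', x', y')" "length ms = length x + length y"
  shows "step_accepts M Before (row ms q x y) (row ms q' x' y')"
proof -
  have prefix: "step_accepts M Before (row (ms1 @ ms) q (z @ x) y) (row (ms1 @ ms) q' (z @ x') y')"
    if "step_accepts M Before (row ms q x y) (row ms q' x' y')" "length ms1 = length z" for ms1 z ms x x' y y'
    using that(2,1) by (induction ms1 z rule: list_induct2) auto
  have split: "\<exists>ms1 ms2. ms = ms1 @ ms2 \<and> length ms1 = length z \<and> length ms2 = k"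
    if "length ms = length z + k" for z :: "nat list" and k
    using that by (intro exI[of _ "take (length z) ms"] exI[of _ "drop (length z) ms"]) auto
  from assms(1) show ?thesis
  proof cases
    case (row_stay a b y0)
    obtain ms1 ms2 where ms: "ms = ms1 @ ms2" "length ms1 = length x" "length ms2 = Suc (length y0)"
      using split[of x "Suc (length y0)"] assms(2) row_stay by auto
    then obtain m ms3 where "ms2 = m # ms3" "length ms3 = length y0" by (cases ms2) auto
    then show ?thesis using prefix[of ms2 "[]" y "[]" y' ms1 x] ms row_stay step_After[of ms3 y0] by simp
  next
    case (row_left a b c y0)
    obtain ms1 ms2 where ms: "ms = ms1 @ ms2" "length ms1 = length x'" "length ms2 = Suc (Suc (length y0))"
      using split[of x' "Suc (Suc (length y0))"] assms(2) row_left by auto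
    then obtain m m' ms3 where "ms2 = m # m' # ms3" "length ms3 = length y0"
      by (cases ms2; cases "tl ms2") auto
    then show ?thesis using prefix[of ms2 "[c]" y "[]" y' ms1 x'] ms row_left step_After[of ms3 y0] by simp
  next
    case (row_right a b c y0)
    obtain ms1 ms2 where ms: "ms = ms1 @ ms2" "length ms1 = length x" "length ms2 = Suc (Suc (length y0))"
      using split[of x "Suc (Suc (length y0))"] assms(2) row_right by auto
    then obtain m m' ms3 where "ms2 = m # m' # ms3" "length ms3 = length y0"
      by (cases ms2; cases "tl ms2") auto
    then show ?thesis using prefix[of ms2 "[]" y "[b]" y' ms1 x] ms row_right step_After[of ms3 y0] by simp
  qed
qed

subsection \<open>Restarting on the next smaller input\<close>

definition marks :: "nat \<Rightarrow> nat \<Rightarrow> nat \<Rightarrow> nat list" where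
  "marks p j r = replicate p 0 @ replicate j 1 @ replicate r 2"

text \<open>Symbol 2 is the bit \<open>True\<close>, so this is the start state on the unary input
  \<open>j\<close>, between blank margins.\<close>

definition init_row :: "nat \<Rightarrow> nat \<Rightarrow> nat \<Rightarrow> letter list" where
  "init_row p j r = row (marks p j r) 0 (replicate p 0) (replicate j 2 @ replicate r 0)"

datatype part = Left_part | Input_part | Right_part | Bad_part

text \<open>Of the old row only the marks are consulted. The last cell marked 1 is to become the
  first one marked 2: a change too early is caught by \<open>Right_part\<close> meeting a mark 1, a
  change too late by a mark 2 met before it. \<open>Cell 1 1 2\<close> and \<open>Cell 2 1 0\<close>
  carry the head in state 0, the latter when the new input is empty.\<close>

definition restart_dfa :: "part \<Rightarrow> letter \<Rightarrow> letter \<Rightarrow> part" where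
  "restart_dfa s c c' =
     (if s = Left_part \<and> mark c = 0 \<and> c' = Cell 0 0 0 then Left_part
      else if s = Left_part \<and> mark c = 1 \<and> c' = Cell 1 1 2 then Input_part
      else if s = Left_part \<and> mark c = 1 \<and> c' = Cell 2 1 0 then Right_part
      else if s = Input_part \<and> mark c = 1 \<and> c' = Cell 1 0 2 then Input_part
      else if s = Input_part \<and> mark c = 1 \<and> c' = Cell 2 0 0 then Right_part
      else if s = Right_part \<and> mark c = 2 \<and> c' = Cell 2 0 0 then Right_part
      else Bad_part)"

lemma restart_dfa_simps:
  "restart_dfa Bad_part c b = Bad_part"
  "mark c = 2 \<Longrightarrow> restart_dfa Left_part c b = Bad_part"
  "mark c = 2 \<Longrightarrow> restart_dfa Input_part c b = Bad_part"
  "mark c = Suc 0 \<Longrightarrow> restart_dfa Right_part c b = Bad_part"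
  "mark c = 0 \<Longrightarrow> restart_dfa Left_part c b = (if b = Cell 0 0 0 then Left_part else Bad_part)"
  "mark c = Suc 0 \<Longrightarrow> restart_dfa Left_part c b =
     (if b = Cell (Suc 0) (Suc 0) 2 then Input_part else if b = Cell 2 (Suc 0) 0 then Right_part else Bad_part)"
  "mark c = Suc 0 \<Longrightarrow> restart_dfa Input_part c b =
     (if b = Cell (Suc 0) 0 2 then Input_part else if b = Cell 2 0 0 then Right_part else Bad_part)"
  "mark c = 2 \<Longrightarrow> restart_dfa Right_part c b = (if b = Cell 2 0 0 then Right_part else Bad_part)"
  by (simp_all add: restart_dfa_def)

abbreviation "restart_accepts \<equiv> pair_accepts restart_dfa (\<lambda>s. s = Right_part)"

lemma restart_fail: "\<not> restart_accepts Bad_part u v"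
  by (induction u v rule: list_induct2') (auto simp: restart_dfa_simps)

lemma restart_state2: "map mark u = replicate r 2 \<Longrightarrow>
    restart_accepts Right_part u v \<longleftrightarrow> v = plain_row (replicate r 2) (replicate r 0)"
proof (induction u arbitrary: r v)
  case Nil
  then show ?case by (auto simp: pair_accepts_Nil)
next
  case (Cons c u)
  then obtain r' where "r = Suc r'" "mark c = 2" "map mark u = replicate r' 2" by (cases r) auto
  then show ?case using Cons.IH[of r']
    by (auto simp: pair_accepts_Cons restart_dfa_simps restart_fail split: if_splits)
qed

lemma restart_state1: "map mark u = replicate j 1 @ replicate r 2 \<Longrightarrow>
    restart_accepts Input_part u v \<longleftrightarrow> 0 < j \<and>
      v = plain_row (replicate (j - 1) 1 @ replicate (Suc r) 2) (replicate (j - 1) 2 @ replicate (Suc r) 0)"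
proof (induction u arbitrary: j v)
  case Nil
  then show ?case by (auto simp: pair_accepts_Nil)
next
  case (Cons c u)
  show ?case
  proof (cases j)
    case 0
    then obtain r' where "r = Suc r'" "mark c = 2" using Cons.prems by (cases r) auto
    then show ?thesis using 0 by (auto simp: pair_accepts_Cons restart_dfa_simps restart_fail)
  next
    case (Suc j')
    then have c: "mark c = 1" "map mark u = replicate j' 1 @ replicate r 2" using Cons.prems by simp_all
    have "restart_accepts Input_part (c # u) v \<longleftrightarrow> (\<exists>v'. v = Cell 1 0 2 # v' \<and> restart_accepts Input_part u v') \<or>
        (\<exists>v'. v = Cell 2 0 0 # v' \<and> restart_accepts Right_part u v')"
    proof (cases v)
      case (Cons b v')
      then show ?thesis using c(1)
        by (cases "b = Cell 1 0 2"; cases "b = Cell 2 0 0") (simp_all add: restart_dfa_simps restart_fail)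
    qed simp
    also have "\<dots> \<longleftrightarrow> v = plain_row (replicate j' 1 @ replicate (Suc r) 2) (replicate j' 2 @ replicate (Suc r) 0)"
    proof (cases j')
      case 0
      then show ?thesis using Cons.IH[OF c(2)] restart_state2[of u r] c(2) by simp
    next
      case (Suc i)
      then obtain c' u' where "u = c' # u'" "mark c' = 1" using c(2) by (cases u) auto
      \<comment> \<open>A further cell marked 1 follows, so the input cannot be cut off
        here.\<close>
      then have "\<not> restart_accepts Right_part u v'" for v'
         by (auto simp: pair_accepts_Cons restart_dfa_simps restart_fail)
      then show ?thesis using Cons.IH[OF c(2)] Suc by auto
    qed
    finally show ?thesis using Suc by simp
  qed
qed

text \<open>The cell that leaves the input joins the right margin, so the segment keeps its length;
  no restart is possible from input 0.\<close>

lemma restart_iff: "map mark u = marks p j r \<Longrightarrow>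
    restart_accepts Left_part u v \<longleftrightarrow> 0 < j \<and> v = init_row p (j - 1) (Suc r)"
proof (induction p arbitrary: u v)
  case 0
  show ?case
  proof (cases u)
    case Nil
    then show ?thesis using 0 by (auto simp: pair_accepts_Nil marks_def)
  next
    case (Cons c u')
    show ?thesis
    proof (cases j)
      case 0
      then have "mark c = 2" using "0.prems" Cons by (cases r) (auto simp: marks_def)
      then show ?thesis using 0 Cons by (auto simp: pair_accepts_Cons restart_dfa_simps restart_fail)
    next
      case (Suc j')
      then have c: "mark c = 1" "map mark u' = replicate j' 1 @ replicate r 2"
        using "0.prems" Cons by (auto simp: marks_def)
      have "restart_accepts Left_part u v \<longleftrightarrow> (\<exists>v'. v = Cell 1 1 2 # v' \<and> restart_accepts Input_part u' v') \<or>
          (\<exists>v'. v = Cell 2 1 0 # v' \<and> restart_accepts Right_part u' v')"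
      proof (cases v)
        case v: (Cons b v')
        then show ?thesis using Cons c(1)
          by (cases "b = Cell 1 1 2"; cases "b = Cell 2 1 0") (simp_all add: restart_dfa_simps restart_fail)
      qed (simp add: Cons)
      also have "\<dots> \<longleftrightarrow> v = init_row 0 j' (Suc r)"
      proof (cases j')
        case 0
        then show ?thesis using restart_state1[OF c(2)] restart_state2[of u' r] c(2)
          by (simp add: init_row_def marks_def)
      next
        case (Suc i)
        then obtain c' u'' where "u' = c' # u''" "mark c' = 1" using c(2) by (cases u') auto
        then have "\<not> restart_accepts Right_part u' v'" for v'
           by (auto simp: pair_accepts_Cons restart_dfa_simps restart_fail)
        then show ?thesis using restart_state1[OF c(2)] Suc by (auto simp: init_row_def marks_def)
      qed
      finally show ?thesis using Suc by simp
    qed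
  qed
next
  case (Suc p)
  then obtain c u' where u: "u = c # u'" "mark c = 0" "map mark u' = marks p j r"
    by (cases u) (auto simp: marks_def)
  have "restart_accepts Left_part u v \<longleftrightarrow> (\<exists>v'. v = Cell 0 0 0 # v' \<and> restart_accepts Left_part u' v')"
  proof (cases v)
    case (Cons b v')
    then show ?thesis using u
      by (cases "b = Cell 0 0 0") (simp_all add: restart_dfa_simps restart_fail)
  qed (simp add: u)
  also have "\<dots> \<longleftrightarrow> 0 < j \<and> v = init_row (Suc p) (j - 1) (Suc r)"
    using Suc.IH[OF u(3)] by (auto simp: init_row_def marks_def)
  finally show ?case .
qed

definition halt_dfa :: "tm \<Rightarrow> bool \<Rightarrow> letter \<Rightarrow> letter \<Rightarrow> bool" where
  "halt_dfa M s c c' \<longleftrightarrow> s \<or> halting M c"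

lemma halt_accepts_iff: "pair_accepts (halt_dfa M) (\<lambda>s. s) s u v \<longleftrightarrow>
    length u = length v \<and> (s \<or> (\<exists>c\<in>set u. halting M c))"
  by (induction u v arbitrary: s rule: list_induct2') (auto simp: halt_dfa_def)

lemma eq_accepts_iff: "pair_accepts (\<lambda>s c c'. s \<and> c = c') (\<lambda>s. s) s u v \<longleftrightarrow> s \<and> u = v"
  by (induction u v arbitrary: s rule: list_induct2') auto

section \<open>Valid words\<close>

text \<open>
  A linear grammar compares words from the outside inwards, so a row is followed by the reversal of its
  successor; the link separator then restores the forward orientation.
\<close>

inductive chain :: "tm \<Rightarrow> letter list \<Rightarrow> letter list \<Rightarrow> bool" for M where
  chain_stop: "u \<in> lists (cells M) \<Longrightarrow> 1 \<notin> mark ` set u \<Longrightarrow> \<exists>c\<in>set u. halting M c \<Longrightarrow> chain M u u"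
| chain_step: "u \<in> lists (cells M) \<Longrightarrow> v \<in> lists (cells M) \<Longrightarrow> step_accepts M Before u v \<Longrightarrow>
    chain M v w \<Longrightarrow> chain M u (u @ Step_sep # rev v @ Link_sep # w)"
| chain_restart: "u \<in> lists (cells M) \<Longrightarrow> v \<in> lists (cells M) \<Longrightarrow> restart_accepts Left_part u v \<Longrightarrow>
    \<exists>c\<in>set u. halting M c \<Longrightarrow>
    chain M v w \<Longrightarrow> chain M u (u @ Restart_sep # rev v @ Link_sep # w)"

text \<open>State 0 means a forward row, 1 a reversed row and 2 failure. Ending in state 0 says that
  the separators alternate properly and that the last row is a forward one.\<close>

definition format_dfa :: "nat \<Rightarrow> letter \<Rightarrow> nat" where
  "format_dfa s c = (case c of Cell _ _ _ \<Rightarrow> s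
     | Link_sep \<Rightarrow> if s = 1 then 0 else 2
     | _ \<Rightarrow> if s = 0 then 1 else 2)"

text \<open>State 2 records a mark 1 in the current row, state 1 a halting cell but no mark 1.\<close>

definition final_dfa :: "tm \<Rightarrow> nat \<Rightarrow> letter \<Rightarrow> nat" where
  "final_dfa M s c = (case c of Cell m _ _ \<Rightarrow> if m = 1 \<or> s = 2 then 2 else if halting M c then 1 else s
     | _ \<Rightarrow> 0)"

definition pairs_ok :: "tm \<Rightarrow> letter list \<Rightarrow> bool" where
  "pairs_ok M w \<longleftrightarrow>
     pair_ok (cells M) Step_sep (step_accepts M Before) w \<and>
     pair_ok (cells M) Restart_sep (restart_accepts Left_part) w \<and>
     pair_ok (cells M) Restart_sep (pair_accepts (halt_dfa M) (\<lambda>s. s) False) w \<and>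
     pair_ok (cells M) Link_sep (pair_accepts (\<lambda>s c c'. s \<and> c = c') (\<lambda>s. s) True) w"

section \<open>Chains as the words that pass all local tests\<close>

lemma foldl_absorb: "(\<And>a. a \<in> set w \<Longrightarrow> f s a = s) \<Longrightarrow> foldl f s w = s"
  by (induction w) auto

lemma cells_cases: "c \<in> cells M \<Longrightarrow> (\<And>m h a. c = Cell m h a \<Longrightarrow> m < 3 \<Longrightarrow> P) \<Longrightarrow> P"
  by (auto simp: cells_def)

lemma format_cells: "u \<in> lists (cells M) \<Longrightarrow> foldl format_dfa s u = s"
proof (rule foldl_absorb)
  fix c assume "u \<in> lists (cells M)" "c \<in> set u"
  then have "c \<in> cells M" by auto
  then show "format_dfa s c = s" by (auto simp: format_dfa_def cells_def)
qed

lemma format_fail: "foldl format_dfa 2 w = 2"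
  by (rule foldl_absorb) (auto simp: format_dfa_def split: letter.splits)

lemma final_cells: "u \<in> lists (cells M) \<Longrightarrow> s < 2 \<Longrightarrow>
    foldl (final_dfa M) s u = 1 \<longleftrightarrow> 1 \<notin> mark ` set u \<and> (s = 1 \<or> (\<exists>c\<in>set u. halting M c))"
proof (induction u arbitrary: s rule: lists.induct)
  case (Cons c u)
  then obtain m h a where c: "c = Cell m h a" by (auto elim: cells_cases)
  show ?case
  proof (cases "m = 1")
    case True
    then have "foldl (final_dfa M) s (c # u) = foldl (final_dfa M) 2 u" using c by (simp add: final_dfa_def)
    also have "\<dots> = 2"
    proof (rule foldl_absorb)
      fix d assume "d \<in> set u"
      then have "d \<in> cells M" using Cons.hyps by auto
      then show "final_dfa M 2 d = 2" by (auto simp: final_dfa_def cells_def)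
    qed
    finally show ?thesis using True c by simp
  next
    case False
    then have "foldl (final_dfa M) s (c # u) = foldl (final_dfa M) (if halting M c then 1 else s) u"
      using c Cons.prems by (simp add: final_dfa_def)
    then show ?thesis using Cons.IH[of "if halting M c then 1 else s"] Cons.prems False c by auto
  qed
qed simp

lemma pairs_ok_cells: "u \<in> lists (cells M) \<Longrightarrow> pairs_ok M u"
  by (simp add: pairs_ok_def pair_ok_cells del: in_lists_conv_set)

lemma pairs_ok_sep:
  assumes "u \<in> lists (cells M)" "v \<in> lists (cells M)" "s \<notin> cells M" "\<beta> = [] \<or> hd \<beta> \<notin> cells M"
  shows "pairs_ok M (u @ s # v @ \<beta>) \<longleftrightarrow> pairs_ok M (v @ \<beta>) \<and>
    (s = Step_sep \<longrightarrow> step_accepts M Before u (rev v)) \<and>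
    (s = Restart_sep \<longrightarrow> restart_accepts Left_part u (rev v) \<and> length u = length v \<and> (\<exists>c\<in>set u. halting M c)) \<and>
    (s = Link_sep \<longrightarrow> u = rev v)"
  unfolding pairs_ok_def
  by (simp add: pair_ok_sep[OF assms(1-3) _ assms(4)] halt_accepts_iff eq_accepts_iff) blast

lemma pair_accepts_length: "pair_accepts \<delta> F s u v \<Longrightarrow> length u = length v"
  by (induction u v arbitrary: s rule: list_induct2') auto

lemma chain_starts: "chain M u w \<Longrightarrow> u \<in> lists (cells M) \<and> (\<exists>\<beta>. w = u @ \<beta> \<and> (\<beta> = [] \<or> hd \<beta> \<notin> cells M))"
  by (erule chain.cases) (auto simp del: in_lists_conv_set)

lemma cells_subset_letters: "cells M \<subseteq> letters M"
  by (auto simp: letters_def)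

lemma lists_cells_letters: "u \<in> lists (cells M) \<Longrightarrow> u \<in> lists (letters M)"
  using lists_mono[OF cells_subset_letters] by blast

text \<open>The induction step shared by both kinds of separator. The format test is back in state 0
  after two separators, \<open>final_dfa\<close> forgets everything before a separator, and
  \<open>pairs_ok_sep\<close> handles the two new blocks.\<close>

lemma chain_block:
  assumes uv: "u \<in> lists (cells M)" "v \<in> lists (cells M)" and t: "t = Step_sep \<or> t = Restart_sep"
    and w: "w = v @ \<beta>" "\<beta> = [] \<or> hd \<beta> \<notin> cells M"
    and *: "w \<in> lists (letters M)" "foldl format_dfa 0 w = 0" "foldl (final_dfa M) 0 w = 1" "pairs_ok M w"
    and rel: "t = Step_sep \<longrightarrow> step_accepts M Before u v"
      "t = Restart_sep \<longrightarrow> restart_accepts Left_part u v \<and> (\<exists>c\<in>set u. halting M c)"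
  defines "w' \<equiv> u @ t # rev v @ Link_sep # w"
  shows "w' \<in> lists (letters M) \<and> foldl format_dfa 0 w' = 0 \<and> foldl (final_dfa M) 0 w' = 1 \<and> pairs_ok M w'"
proof (intro conjI)
  have rv: "rev v \<in> lists (cells M)" using uv(2) by (simp add: in_lists_conv_set)
  have t': "t \<notin> cells M" "t \<noteq> Link_sep" using t by auto
  show "w' \<in> lists (letters M)"
    using lists_cells_letters[OF uv(1)] lists_cells_letters[OF rv] *(1) t by (auto simp: w'_def letters_def)
  show "foldl format_dfa 0 w' = 0"
    using t *(2) by (auto simp: w'_def format_cells[OF uv(1)] format_cells[OF rv] format_dfa_def)
  show "foldl (final_dfa M) 0 w' = 1"
    using *(3) by (simp add: w'_def final_dfa_def)
  have "pairs_ok M (rev v @ Link_sep # v @ \<beta>)"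
    using pairs_ok_sep[OF rv uv(2) _ w(2), of Link_sep] *(4) w(1) by simp
  then have "pairs_ok M (u @ t # rev v @ (Link_sep # v @ \<beta>))"
    using pairs_ok_sep[OF uv(1) rv t'(1), of "Link_sep # v @ \<beta>"] rel t' pair_accepts_length[of restart_dfa _ _ u v]
    by auto
  then show "pairs_ok M w'" by (simp add: w'_def w(1))
qed

lemma chain_imp_ok:
  "chain M u w \<Longrightarrow>
    w \<in> lists (letters M) \<and> foldl format_dfa 0 w = 0 \<and> foldl (final_dfa M) 0 w = 1 \<and> pairs_ok M w"
proof (induction rule: chain.induct)
  case (chain_stop u)
  then show ?case
    using lists_cells_letters[of u M] format_cells[of u M 0] final_cells[of u M 0] pairs_ok_cells[of u M]
    by simp
next
  case (chain_step u v w)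
  obtain \<beta> where "w = v @ \<beta>" "\<beta> = [] \<or> hd \<beta> \<notin> cells M" using chain_starts[OF chain_step(4)] by blast
  then show ?case using chain_step by (intro chain_block[of u M v Step_sep w \<beta>]) simp_all
next
  case (chain_restart u v w)
  obtain \<beta> where "w = v @ \<beta>" "\<beta> = [] \<or> hd \<beta> \<notin> cells M" using chain_starts[OF chain_restart(5)] by blast
  then show ?case using chain_restart by (intro chain_block[of u M v Restart_sep w \<beta>]) simp_all
qed

lemma split_row:
  "\<exists>u \<beta>. w = u @ \<beta> \<and> u \<in> lists C \<and> (\<beta> = [] \<or> hd \<beta> \<notin> C)"
proof (rule exI[of _ "takeWhile (\<lambda>c. c \<in> C) w"], rule exI[of _ "dropWhile (\<lambda>c. c \<in> C) w"])
qed (use hd_dropWhile[of "\<lambda>c. c \<in> C" w] in \<open>auto dest: set_takeWhileD\<close>)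

text \<open>The format forces a separator, a block, a link and a remainder. The link makes the block
  the reversal of the first row of the remainder, to which the induction hypothesis applies.\<close>

lemma ok_imp_chain:
  assumes "w \<in> lists (letters M)" "foldl format_dfa 0 w = 0" "foldl (final_dfa M) 0 w = 1" "pairs_ok M w"
    and "w = u @ \<beta>" "u \<in> lists (cells M)" "\<beta> = [] \<or> hd \<beta> \<notin> cells M"
  shows "chain M u w"
  using assms
proof (induction "length w" arbitrary: w u \<beta> rule: less_induct)
  case less
  note w = less.prems
  show ?case
  proof (cases \<beta>)
    case Nil
    then show ?thesis using w final_cells[of u M 0] chain_stop[of u M] by simp
  next
    case (Cons t w1)
    then have t: "t \<in> letters M" "t \<notin> cells M" using w by auto
    obtain v \<gamma> where v: "w1 = v @ \<gamma>" "v \<in> lists (cells M)" "\<gamma> = [] \<or> hd \<gamma> \<notin> cells M"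
      using split_row[of w1 "cells M"] by metis
    have f: "foldl format_dfa (format_dfa 0 t) \<gamma> = 0"
      using w(2) w(5) Cons v(1) by (simp add: format_cells[OF w(6)] format_cells[OF v(2)])
    then have "t \<noteq> Link_sep" using format_fail by (auto simp: format_dfa_def)
    then have t': "t = Step_sep \<or> t = Restart_sep" using t by (auto simp: letters_def)
    then have f1: "foldl format_dfa 1 \<gamma> = 0" using f by (auto simp: format_dfa_def)
    then obtain s w2 where s: "\<gamma> = s # w2" by (cases \<gamma>) auto
    then have "s \<in> letters M" "s \<notin> cells M" using w(1,5) v Cons by auto
    then have s': "s = Link_sep" using f1 s format_fail by (auto simp: format_dfa_def letters_def)
    obtain v' \<delta> where v': "w2 = v' @ \<delta>" "v' \<in> lists (cells M)" "\<delta> = [] \<or> hd \<delta> \<notin> cells M"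
      using split_row[of w2 "cells M"] by metis
    have weq: "w = u @ t # v @ \<gamma>" using w(5) Cons v(1) by simp
    have 1: "pairs_ok M (v @ \<gamma>)" and
      rel: "t = Step_sep \<longrightarrow> step_accepts M Before u (rev v)"
        "t = Restart_sep \<longrightarrow> restart_accepts Left_part u (rev v) \<and> (\<exists>c\<in>set u. halting M c)"
      using w(4) unfolding weq pairs_ok_sep[OF w(6) v(2) t(2) v(3)] by auto
    have 2: "pairs_ok M w2" "v = rev v'"
      using 1 unfolding s s' v'(1) using pairs_ok_sep[OF v(2) v'(2) _ v'(3), of Link_sep] by auto
    have "chain M v' w2"
    proof (rule less.hyps[OF _ _ _ _ 2(1) v'])
      show "length w2 < length w" using weq s by simp
      show "w2 \<in> lists (letters M)" using w(1) weq s by simp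
      show "foldl format_dfa 0 w2 = 0" using f1 s s' by (simp add: format_dfa_def)
      show "foldl (final_dfa M) 0 w2 = 1" using w(3) weq s s' by (simp add: final_dfa_def)
    qed
    then show ?thesis
      using t' rel chain_step[OF w(6) v'(2)] chain_restart[OF w(6) v'(2)] 2(2) weq s s' by auto
  qed
qed

subsection \<open>The first row\<close>

text \<open>State 2 is the right margin of the first row, 3 everything after a correct first row, 4
  failure. Both 2 and 3 will accept, since a word may consist of a single row.\<close>

definition init_dfa :: "nat \<Rightarrow> letter \<Rightarrow> nat" where
  "init_dfa s c =
     (if s = 0 \<and> c = Cell 0 0 0 then 0
      else if s = 0 \<and> c = Cell 1 1 2 then 1
      else if s = 1 \<and> c = Cell 1 0 2 then 1
      else if (s = 1 \<or> s = 2) \<and> c = Cell 2 0 0 then 2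
      else if s = 3 \<or> s = 2 \<and> c \<in> {Step_sep, Restart_sep, Link_sep} then 3
      else 4)"

text \<open>States below \<open>n\<close> count the cells marked 1 modulo \<open>n\<close>;
  \<open>n\<close> and \<open>n + 1\<close> freeze the verdict at the first separator, so that only
  the first row is counted.\<close>

definition dvd_dfa :: "nat \<Rightarrow> nat \<Rightarrow> letter \<Rightarrow> nat" where
  "dvd_dfa n s c = (if n \<le> s then s
     else case c of Cell m _ _ \<Rightarrow> if m = 1 then Suc s mod n else s | _ \<Rightarrow> if s = 0 then n else n + 1)"

lemma init_dfa_simps:
  "init_dfa 0 (Cell 0 0 0) = 0"
  "init_dfa 0 (Cell (Suc 0) (Suc 0) 2) = Suc 0"
  "init_dfa (Suc 0) (Cell (Suc 0) 0 2) = Suc 0"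
  "init_dfa (Suc 0) (Cell 2 0 0) = 2"
  "init_dfa 2 (Cell 2 0 0) = 2"
  "init_dfa 3 c = 3"
  "init_dfa 4 c = 4"
  by (simp_all add: init_dfa_def)

lemma init_fail: "foldl init_dfa 4 w = 4"
  by (rule foldl_absorb) (simp add: init_dfa_simps)

lemma init_pass: "foldl init_dfa 3 w = 3"
  by (rule foldl_absorb) (simp add: init_dfa_simps)

lemma init_state2: "foldl init_dfa 2 u = 2 \<Longrightarrow> \<exists>r. u = plain_row (replicate r 2) (replicate r 0)"
proof (induction u)
  case Nil
  show ?case by (rule exI[of _ 0]) simp
next
  case (Cons c u)
  then have c: "init_dfa 2 c \<noteq> 4" "init_dfa 2 c \<noteq> 3" using init_fail[of u] init_pass[of u] by auto
  then have "c = Cell 2 0 0" by (auto simp: init_dfa_def split: if_splits)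
  moreover from this obtain r where "u = plain_row (replicate r 2) (replicate r 0)"
    using Cons by (auto simp: init_dfa_simps)
  ultimately show ?case by (intro exI[of _ "Suc r"]) simp
qed

lemma init_state1: "foldl init_dfa 1 u = 2 \<Longrightarrow>
    \<exists>j r. 0 < r \<and> u = plain_row (replicate j 1 @ replicate r 2) (replicate j 2 @ replicate r 0)"
proof (induction u)
  case (Cons c u)
  then have "init_dfa 1 c \<noteq> 4" using init_fail[of u] by auto
  then consider "c = Cell 1 0 2" | "c = Cell 2 0 0" by (auto simp: init_dfa_def split: if_splits)
  then show ?case
  proof cases
    case 1
    then obtain j r where "0 < r" "u = plain_row (replicate j 1 @ replicate r 2) (replicate j 2 @ replicate r 0)"
      using Cons by (auto simp: init_dfa_simps)
    then show ?thesis using 1 by (intro exI[of _ "Suc j"] exI[of _ r]) simp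
  next
    case 2
    then obtain r where "u = plain_row (replicate r 2) (replicate r 0)"
      using Cons.prems init_state2[of u] by (auto simp: init_dfa_simps)
    then show ?thesis using 2 by (intro exI[of _ 0] exI[of _ "Suc r"]) simp
  qed
qed simp

lemma init_state0: "foldl init_dfa 0 u = 2 \<Longrightarrow> \<exists>p j r. 0 < j \<and> 0 < r \<and> u = init_row p j r"
proof (induction u)
  case (Cons c u)
  then have "init_dfa 0 c \<noteq> 4" using init_fail[of u] by auto
  then consider "c = Cell 0 0 0" | "c = Cell 1 1 2" by (auto simp: init_dfa_def split: if_splits)
  then show ?case
  proof cases
    case 1
    then obtain p j r where "0 < j" "0 < r" "u = init_row p j r"
      using Cons by (auto simp: init_dfa_simps)
    then show ?thesis using 1
      by (intro exI[of _ "Suc p"] exI[of _ j] exI[of _ r]) (simp add: init_row_def marks_def)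
  next
    case 2
    then obtain j r where "0 < r" "u = plain_row (replicate j 1 @ replicate r 2) (replicate j 2 @ replicate r 0)"
      using Cons.prems init_state1[of u] by (auto simp: init_dfa_simps)
    then show ?thesis using 2
      by (intro exI[of _ 0] exI[of _ "Suc j"] exI[of _ r]) (simp add: init_row_def marks_def)
  qed
qed simp

lemma init_complete2: "foldl init_dfa 2 (plain_row (replicate r 2) (replicate r 0)) = 2"
  by (induction r) (auto simp: init_dfa_simps)

lemma init_complete1: "0 < r \<Longrightarrow>
    foldl init_dfa 1 (plain_row (replicate j 1 @ replicate r 2) (replicate j 2 @ replicate r 0)) = 2"
proof (induction j)
  case 0
  then obtain r' where "r = Suc r'" by (cases r) auto
  then show ?case using init_complete2[of r'] by (simp add: init_dfa_simps)
qed (simp add: init_dfa_simps)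

lemma init_complete: "0 < j \<Longrightarrow> 0 < r \<Longrightarrow> foldl init_dfa 0 (init_row p j r) = 2"
proof (induction p)
  case 0
  then obtain j' where "j = Suc j'" by (cases j) auto
  then show ?case using init_complete1[of r j'] 0 by (simp add: init_row_def marks_def init_dfa_simps)
qed (simp add: init_row_def marks_def init_dfa_simps)

lemma init_not_pass: "u \<in> lists (cells M) \<Longrightarrow> s \<noteq> 3 \<Longrightarrow> foldl init_dfa s u \<noteq> 3"
proof (induction u arbitrary: s rule: list.induct)
  case (Cons c u)
  then have "init_dfa s c \<noteq> 3" by (auto simp: init_dfa_def elim: cells_cases)
  then show ?case using Cons by simp
qed simp

lemma init_iff:
  assumes "u \<in> lists (cells M)" "\<beta> = [] \<or> hd \<beta> \<in> {Step_sep, Restart_sep, Link_sep}"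
  shows "foldl init_dfa 0 (u @ \<beta>) \<in> {2, 3} \<longleftrightarrow> (\<exists>p j r. 0 < j \<and> 0 < r \<and> u = init_row p j r)"
proof -
  have "foldl init_dfa 0 (u @ \<beta>) \<in> {2, 3} \<longleftrightarrow> foldl init_dfa 0 u = 2"
  proof (cases \<beta>)
    case Nil
    then show ?thesis using init_not_pass[OF assms(1), of 0] by simp
  next
    case (Cons c w)
    then have "init_dfa s c = (if s = 2 \<or> s = 3 then 3 else 4)" for s
      using assms(2) by (auto simp: init_dfa_def)
    then show ?thesis using Cons init_pass init_fail init_not_pass[OF assms(1), of 0] by simp
  qed
  also have "\<dots> \<longleftrightarrow> (\<exists>p j r. 0 < j \<and> 0 < r \<and> u = init_row p j r)"
    using init_state0 init_complete by blast
  finally show ?thesis .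
qed

lemma dvd_pass: "n \<le> s \<Longrightarrow> foldl (dvd_dfa n) s w = s"
  by (rule foldl_absorb) (simp add: dvd_dfa_def)

lemma dvd_cells: "u \<in> lists (cells M) \<Longrightarrow> s < n \<Longrightarrow>
    foldl (dvd_dfa n) s u = (s + count_list (map mark u) 1) mod n"
proof (induction u arbitrary: s rule: list.induct)
  case (Cons c u)
  then obtain m h a where c: "c = Cell m h a" by (auto elim: cells_cases)
  then have "foldl (dvd_dfa n) s (c # u) = foldl (dvd_dfa n) (if m = 1 then Suc s mod n else s) u"
    using Cons.prems by (simp add: dvd_dfa_def)
  also have "\<dots> = ((if m = 1 then Suc s mod n else s) + count_list (map mark u) 1) mod n"
    by (rule Cons.IH) (use Cons.prems in auto)
  also have "\<dots> = (s + count_list (map mark (c # u)) 1) mod n"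
    using c by (simp add: mod_simps)
  finally show ?case .
qed simp

lemma dvd_iff:
  assumes "u \<in> lists (cells M)" "\<beta> = [] \<or> hd \<beta> \<in> {Step_sep, Restart_sep, Link_sep}" "0 < n"
  shows "foldl (dvd_dfa n) 0 (u @ \<beta>) \<in> {0, n} \<longleftrightarrow> n dvd count_list (map mark u) 1"
proof -
  let ?k = "count_list (map mark u) 1 mod n"
  have u: "foldl (dvd_dfa n) 0 u = ?k" "?k < n" using dvd_cells[OF assms(1), of 0 n] assms(3) by auto
  show ?thesis
  proof (cases \<beta>)
    case Nil
    then show ?thesis using u by auto
  next
    case (Cons c w)
    then have "dvd_dfa n ?k c = (if ?k = 0 then n else n + 1)"
      using assms(2) u(2) by (auto simp: dvd_dfa_def)
    then have "foldl (dvd_dfa n) 0 (u @ \<beta>) = (if ?k = 0 then n else n + 1)"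
      using u Cons dvd_pass[of n n w] dvd_pass[of n "n + 1" w] by simp
    then show ?thesis by auto
  qed
qed

lemma count_marks: "count_list (marks p j r) 1 = j"
proof -
  have "count_list (replicate j (Suc 0)) (Suc 0) = j" by (induction j) auto
  then show ?thesis by (simp add: marks_def)
qed

lemma mark_init_row: "0 < j + r \<Longrightarrow> map mark (init_row p j r) = marks p j r"
  unfolding init_row_def by (rule mark_row) (auto simp: marks_def)

section \<open>The tests for validity and the number of rules they cost\<close>

definition valid_words :: "tm \<Rightarrow> nat \<Rightarrow> letter list set" where
  "valid_words M n = {w. \<exists>p j r. 0 < j \<and> 0 < r \<and> n dvd j \<and> Suc n dvd j \<and> chain M (init_row p j r) w}"

lemma valid_words_letters: "valid_words M n \<subseteq> lists (letters M)"
  using chain_imp_ok by (auto simp: valid_words_def simp del: in_lists_conv_set)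

lemma valid_words_iff:
  assumes "w \<in> lists (letters M)" "0 < n"
  shows "w \<in> valid_words M n \<longleftrightarrow>
    foldl format_dfa 0 w = 0 \<and> foldl (final_dfa M) 0 w = 1 \<and> foldl init_dfa 0 w \<in> {2, 3} \<and>
    foldl (dvd_dfa n) 0 w \<in> {0, n} \<and> foldl (dvd_dfa (Suc n)) 0 w \<in> {0, Suc n} \<and> pairs_ok M w"
proof -
  obtain u \<beta> where w: "w = u @ \<beta>" "u \<in> lists (cells M)" "\<beta> = [] \<or> hd \<beta> \<notin> cells M"
    using split_row[of w "cells M"] by metis
  have \<beta>: "\<beta> = [] \<or> hd \<beta> \<in> {Step_sep, Restart_sep, Link_sep}"
    using w assms(1) by (cases \<beta>) (auto simp: letters_def)
  \<comment> \<open>The first row is the longest prefix of cells. Hence the \<open>j\<close> in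
    \<open>valid_words\<close> is the number that the automata count.\<close>
  have unique: "u' = u" if chain: "chain M u' w" for u'
  proof -
    obtain \<beta>' where \<beta>': "u' \<in> lists (cells M)" "w = u' @ \<beta>'" "\<beta>' = [] \<or> hd \<beta>' \<notin> cells M"
      using chain_starts[OF chain] by blast
    have "u = takeWhile (\<lambda>c. c \<in> cells M) w" "u' = takeWhile (\<lambda>c. c \<in> cells M) w"
      subgoal using w by (auto simp: takeWhile_append takeWhile_eq_Nil_iff)
      subgoal using \<beta>' by (auto simp: takeWhile_append takeWhile_eq_Nil_iff)
      done
    then show ?thesis by simp
  qed
  have count: "count_list (map mark u) 1 = j" if "0 < j" "u = init_row p j r" for p j r
    using mark_init_row[of j r p] count_marks[of p j r] that by simp
  let ?init = "\<exists>p j r. 0 < j \<and> 0 < r \<and> u = init_row p j r"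
  let ?k = "count_list (map mark u) 1"
  have "w \<in> valid_words M n \<longleftrightarrow> chain M u w \<and> ?init \<and> n dvd ?k \<and> Suc n dvd ?k"
  proof
    assume "w \<in> valid_words M n"
    then obtain p j r where 1: "0 < j" "0 < r" "n dvd j" "Suc n dvd j" "chain M (init_row p j r) w"
      unfolding valid_words_def by blast
    then have u: "u = init_row p j r" using unique by simp
    then have k: "?k = j" using count 1(1) by simp
    show "chain M u w \<and> ?init \<and> n dvd ?k \<and> Suc n dvd ?k"
    proof (intro conjI)
      show "chain M u w" using 1(5) u by simp
      show ?init using 1(1,2) u by blast
      show "n dvd ?k" "Suc n dvd ?k" unfolding k by (rule 1)+
    qed
  next
    assume *: "chain M u w \<and> ?init \<and> n dvd ?k \<and> Suc n dvd ?k"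
    then obtain p j r where 1: "0 < j" "0 < r" "u = init_row p j r" by blast
    then have k: "?k = j" using count by simp
    have "n dvd j" "Suc n dvd j" "chain M (init_row p j r) w" using * k 1(3) by simp_all
    then show "w \<in> valid_words M n" using 1(1,2) unfolding valid_words_def by blast
  qed
  also have "chain M u w \<longleftrightarrow> foldl format_dfa 0 w = 0 \<and> foldl (final_dfa M) 0 w = 1 \<and> pairs_ok M w"
    using ok_imp_chain[OF assms(1) _ _ _ w] chain_imp_ok[of M u w] by satx
  finally show ?thesis
    using init_iff[OF w(2) \<beta>] dvd_iff[OF w(2) \<beta>, of n] dvd_iff[OF w(2) \<beta>, of "Suc n"] assms(2) w(1) by auto
qed

text \<open>By De Morgan the invalid words form a union of nine linear languages, one for each
  conjunct of \<open>valid_words_iff\<close> after unfolding \<open>pairs_ok\<close>.\<close>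

lemma lin_invalid_words:
  assumes "tm_wf M"
  shows "\<exists>K a. \<forall>n>0. lin 2 (K + a * n) (lists (letters M) - valid_words M n)"
proof -
  let ?\<Sigma> = "letters M" and ?C = "cells M"
  let ?bad = "\<lambda>\<sigma> P. {w \<in> lists ?\<Sigma>. \<not> pair_ok ?C \<sigma> P w}"
  let ?dfa = "\<lambda>\<delta> F. {w \<in> lists ?\<Sigma>. \<not> F (foldl \<delta> 0 w)}"
  let ?s = "card ?\<Sigma>"
  \<comment> \<open>Well-formedness and the bounds in \<open>cells\<close> keep the expected states
    below \<open>tm_states M\<close>, so this finite set is closed under
    \<open>step_dfa\<close>.\<close>
  let ?Q = "{Before, After, Fail} \<union> Expect_old ` {..<tm_states M} \<union> Expect_new ` {..<tm_states M}"
  have wf: "q' < tm_states M" if "tm_delta M q a = Some (q', b, m)" "q < tm_states M" "a < tm_syms M" for q a q' b m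
    using assms that unfolding tm_wf_def by metis
  have lt: "Step_sep \<in> ?\<Sigma>" "Restart_sep \<in> ?\<Sigma>" "Link_sep \<in> ?\<Sigma>" by (auto simp: letters_def)
  note pair = lin_pair_bad[OF _ finite_letters cells_subset_letters]
  have "\<exists>r. lin 2 r (?bad Step_sep (step_accepts M Before))"
  proof (rule pair[of ?Q])
    show "step_dfa M s a b \<in> ?Q" if "s \<in> ?Q" "a \<in> ?C" "b \<in> ?C" for s a b
      using that(2,3) by (cases "(M, s, a, b)" rule: step_dfa.cases)
        (auto simp: Suc_le_eq split: option.splits move.splits intro!: imageI dest: wf)
  qed (use lt in auto)
  then obtain r1 where 1: "lin 2 r1 (?bad Step_sep (step_accepts M Before))" by blast
  have "\<exists>r. lin 2 r (?bad Restart_sep (restart_accepts Left_part))"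
  proof (rule pair[of UNIV])
    have "(UNIV :: part set) = {Left_part, Input_part, Right_part, Bad_part}"
      using part.exhaust by auto
    then show "finite (UNIV :: part set)" by (metis finite.simps)
  qed (use lt in auto)
  then obtain r2 where 2: "lin 2 r2 (?bad Restart_sep (restart_accepts Left_part))" by blast
  have "\<exists>r. lin 2 r (?bad Restart_sep (pair_accepts (halt_dfa M) (\<lambda>s. s) False))"
    by (rule pair[of UNIV]) (use lt in auto)
  then obtain r3 where 3: "lin 2 r3 (?bad Restart_sep (pair_accepts (halt_dfa M) (\<lambda>s. s) False))" by blast
  have "\<exists>r. lin 2 r (?bad Link_sep (pair_accepts (\<lambda>s c c'. s \<and> c = c') (\<lambda>s. s) True))"
    by (rule pair[of UNIV]) (use lt in auto)
  then obtain r4 where 4: "lin 2 r4 (?bad Link_sep (pair_accepts (\<lambda>s c c'. s \<and> c = c') (\<lambda>s. s) True))" by blast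
  have dfa: "lin 2 (Suc k * ?s + Suc k) (?dfa \<delta> F)"
    if "\<And>s a. s \<le> k \<Longrightarrow> \<delta> s a \<le> k" for \<delta> F and k :: nat
  proof -
    have "lin 1 (card {..k} * ?s + card {..k}) (?dfa \<delta> F)"
      by (rule lin_dfa_compl) (use that finite_letters in auto)
    then show ?thesis by (rule lin_mono) simp_all
  qed
  have 5: "lin 2 (Suc 2 * ?s + Suc 2) (?dfa format_dfa (\<lambda>s. s = 0))"
    by (rule dfa) (auto simp: format_dfa_def split: letter.splits)
  have 6: "lin 2 (Suc 2 * ?s + Suc 2) (?dfa (final_dfa M) (\<lambda>s. s = 1))"
    by (rule dfa) (auto simp: final_dfa_def split: letter.splits)
  have 7: "lin 2 (Suc 4 * ?s + Suc 4) (?dfa init_dfa (\<lambda>s. s \<in> {2, 3}))"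
    by (rule dfa) (auto simp: init_dfa_def)
  have 8: "lin 2 (Suc (n + 1) * ?s + Suc (n + 1)) (?dfa (dvd_dfa n) (\<lambda>s. s \<in> {0, n}))" if "0 < n" for n
  proof (rule dfa)
    fix s a assume "s \<le> n + 1"
    have "Suc s mod n \<le> n + 1" using mod_less_divisor[OF that, of "Suc s"] by simp
    then show "dvd_dfa n s a \<le> n + 1" using \<open>s \<le> n + 1\<close> by (auto simp: dvd_dfa_def split: letter.splits)
  qed
  let ?U = "\<lambda>n. ?bad Step_sep (step_accepts M Before) \<union> ?bad Restart_sep (restart_accepts Left_part) \<union>
    ?bad Restart_sep (pair_accepts (halt_dfa M) (\<lambda>s. s) False) \<union>
    ?bad Link_sep (pair_accepts (\<lambda>s c c'. s \<and> c = c') (\<lambda>s. s) True) \<union>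
    ?dfa format_dfa (\<lambda>s. s = 0) \<union> ?dfa (final_dfa M) (\<lambda>s. s = 1) \<union> ?dfa init_dfa (\<lambda>s. s \<in> {2, 3}) \<union>
    ?dfa (dvd_dfa n) (\<lambda>s. s \<in> {0, n}) \<union> ?dfa (dvd_dfa (Suc n)) (\<lambda>s. s \<in> {0, Suc n})"
  \<comment> \<open>The automata \<open>5\<close> to \<open>7\<close> have 3 + 3 + 5 = 11 states,
    and the two divisibility tests \<open>n + 2\<close> and \<open>n + 3\<close>, that is 5 plus
    \<open>2 * n\<close>; each state costs at most \<open>?s + 1\<close> rules. The 16 comes from
    eight unions.\<close>
  let ?K = "r1 + r2 + r3 + r4 + 11 * (?s + 1) + 5 * (?s + 1) + 16"
  have "lin 2 (?K + 2 * (?s + 1) * n) (lists ?\<Sigma> - valid_words M n)" if "0 < n" for n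
  proof -
    have "lists ?\<Sigma> - valid_words M n = ?U n"
    proof (rule set_eqI)
      fix w
      show "w \<in> lists ?\<Sigma> - valid_words M n \<longleftrightarrow> w \<in> ?U n"
      proof (cases "w \<in> lists ?\<Sigma>")
        case True
        then show ?thesis
          unfolding Diff_iff Un_iff mem_Collect_eq valid_words_iff[OF True that] pairs_ok_def by satx
      next
        case False
        then show ?thesis by (simp only: Diff_iff Un_iff mem_Collect_eq simp_thms)
      qed
    qed
    moreover have "lin 2 (?K + 2 * (?s + 1) * n) (?U n)"
      by (rule lin_mono[OF lin_Un[OF lin_Un[OF lin_Un[OF lin_Un[OF lin_Un[OF lin_Un[OF lin_Un[OF lin_Un[OF
            1 2] 3] 4] 5] 6] 7] 8[OF that]] 8[OF zero_less_Suc, of n]]]) (simp_all add: algebra_simps)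
    ultimately show ?thesis by simp
  qed
  then show ?thesis by blast
qed

section \<open>Runs of the machine\<close>

abbreviation tm_next :: "tm \<Rightarrow> config \<Rightarrow> config \<Rightarrow> bool" where
  "tm_next M c c' \<equiv> tm_step M c = Some c'"

text \<open>Rows have a fixed length, whereas the lists of a configuration grow on demand; the two
  agree up to blanks at the outer ends.\<close>

definition padded :: "config \<Rightarrow> config \<Rightarrow> bool" where
  "padded c c' \<longleftrightarrow> (\<exists>q ls rs a b. c = (q, ls, rs) \<and> c' = (q, ls @ replicate a 0, rs @ replicate b 0))"

lemma scan_pad: "scan (xs @ replicate a 0) = scan xs"
  by (cases xs; cases a) (auto simp: scan_def)

lemma tl_pad: "\<exists>a'. tl (xs @ replicate a 0) = tl xs @ replicate a' 0"
proof (cases xs)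
  case Nil
  then show ?thesis by (intro exI[of _ "a - 1"]) (cases a, auto)
qed auto

lemma padded_step_None: "tm_step M c = None \<Longrightarrow> padded c c' \<Longrightarrow> tm_step M c' = None"
  by (auto simp: padded_def scan_pad split: option.splits)

lemma padded_step_Some:
  assumes "tm_next M c d" "padded c c'"
  shows "\<exists>d'. tm_next M c' d' \<and> padded d d'"
proof -
  obtain q ls rs a b where c: "c = (q, ls, rs)" "c' = (q, ls @ replicate a 0, rs @ replicate b 0)"
    using assms(2) unfolding padded_def by blast
  obtain q' s m where \<delta>: "tm_delta M q (scan rs) = Some (q', s, m)"
    using assms(1) c by (auto split: option.splits)
  obtain a' where a': "tl (ls @ replicate a 0) = tl ls @ replicate a' 0" using tl_pad by blast
  obtain b' where b': "tl (rs @ replicate b 0) = tl rs @ replicate b' 0" using tl_pad by blast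
  show ?thesis
  proof (cases m)
    case MLeft
    have "d = (q', tl ls, scan ls # s # tl rs)" using assms(1) c \<delta> MLeft by simp
    moreover have "tm_next M c' (q', tl ls @ replicate a' 0, (scan ls # s # tl rs) @ replicate b' 0)"
      using c \<delta> MLeft a' b' by (simp add: scan_pad)
    ultimately show ?thesis unfolding padded_def by blast
  next
    case MStay
    have "d = (q', ls, s # tl rs)" using assms(1) c \<delta> MStay by simp
    moreover have "tm_next M c' (q', ls @ replicate a 0, (s # tl rs) @ replicate b' 0)"
      using c \<delta> MStay b' by (simp add: scan_pad)
    ultimately show ?thesis unfolding padded_def by blast
  next
    case MRight
    have "d = (q', s # ls, tl rs)" using assms(1) c \<delta> MRight by simp
    moreover have "tm_next M c' (q', (s # ls) @ replicate a 0, tl rs @ replicate b' 0)"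
      using c \<delta> MRight b' by (simp add: scan_pad)
    ultimately show ?thesis unfolding padded_def by blast
  qed
qed

lemma padded_steps:
  "(tm_next M ^^ k) c d \<Longrightarrow> padded c c' \<Longrightarrow> \<exists>d'. (tm_next M ^^ k) c' d' \<and> padded d d'"
proof (induction k arbitrary: d)
  case 0
  then show ?case by auto
next
  case (Suc k)
  then obtain e where e: "(tm_next M ^^ k) c e" "tm_next M e d" by auto
  then obtain e' where e': "(tm_next M ^^ k) c' e'" "padded e e'" using Suc by blast
  then obtain d' where "tm_next M e' d'" "padded d d'" using padded_step_Some e(2) by blast
  have "(tm_next M ^^ Suc k) c' d'" by (rule relpowp_Suc_I[OF e'(1) \<open>tm_next M e' d'\<close>])
  then show ?case using \<open>padded d d'\<close> by blast
qed

lemma halting_config_unique: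
  assumes "(tm_next M)\<^sup>*\<^sup>* c d" "(tm_next M)\<^sup>*\<^sup>* c d'" "tm_step M d = None" "tm_step M d' = None"
  shows "d = d'"
  using assms
proof (induction rule: converse_rtranclp_induct)
  case base
  from base(1) show ?case by (cases rule: converse_rtranclpE) (use base(2) in simp_all)
next
  case (step c e)
  from step.prems(1) obtain e' where "tm_next M c e'" "(tm_next M)\<^sup>*\<^sup>* e' d'"
    by (cases rule: converse_rtranclpE) (use step.hyps(1) step.prems(3) in simp_all)
  then have "(tm_next M)\<^sup>*\<^sup>* e d'" using step.hyps(1) by simp
  then show ?case by (rule step.IH[OF _ step.prems(2,3)])
qed

definition padded_start :: "nat \<Rightarrow> nat \<Rightarrow> nat \<Rightarrow> config" where
  "padded_start p j r = (0, replicate p 0, replicate j 2 @ replicate r 0)"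

lemma padded_start: "padded (0, [], replicate j 2) (padded_start p j r)"
  unfolding padded_def padded_start_def
  by (intro exI[of _ 0] exI[of _ "[]"] exI[of _ "replicate j 2"] exI[of _ p] exI[of _ r]) simp

lemma takeWhile_pad: "takeWhile (\<lambda>a. a \<noteq> 0) (xs @ replicate b 0) = takeWhile (\<lambda>a. a \<noteq> (0::nat)) xs"
  by (induction xs) auto

text \<open>By determinism, the padded run halts in a padded copy of the halting configuration of
  the true run. Padding with blanks does not change the output, which therefore lies within
  \<open>y\<close>.\<close>

lemma output_fits:
  assumes out: "tm_outputs M (replicate j 2) (replicate k 2)"
    and run: "(tm_next M)\<^sup>*\<^sup>* (padded_start p j r) (q, l, y)" and halt: "tm_delta M q (scan y) = None"
  shows "k \<le> length y"
proof -
  obtain q0 l0 y0 where 0: "(tm_next M)\<^sup>*\<^sup>* (0, [], replicate j 2) (q0, l0, y0)"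
    "tm_step M (q0, l0, y0) = None" "takeWhile (\<lambda>a. a \<noteq> 0) y0 = replicate k 2"
    using out unfolding tm_outputs_def by blast
  then obtain n where "(tm_next M ^^ n) (0, [], replicate j 2) (q0, l0, y0)"
    using rtranclp_imp_relpowp by metis
  then obtain d where d: "(tm_next M ^^ n) (padded_start p j r) d" "padded (q0, l0, y0) d"
    using padded_steps padded_start by blast
  have "d = (q, l, y)"
    by (rule halting_config_unique[OF relpowp_imp_rtranclp[OF d(1)] run])
      (use padded_step_None[OF 0(2) d(2)] halt in auto)
  then obtain b where "y = y0 @ replicate b 0" using d(2) unfolding padded_def by auto
  then have "takeWhile (\<lambda>a. a \<noteq> 0) y = replicate k 2" using 0(3) takeWhile_pad by metis
  then show ?thesis by (metis length_replicate length_takeWhile_le)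
qed

section \<open>From chains to runs and back\<close>

lemma init_row_start: "init_row p j r = row (marks p j r) 0 (rev (replicate p 0)) (replicate j 2 @ replicate r 0)"
  by (simp add: init_row_def)

lemma length_marks: "length (marks p j r) = p + j + r"
  by (simp add: marks_def)

text \<open>The generalisation to rows reached from the start on input \<open>j\<close> carries the
  induction. A chain can end only when no mark 1 is left, so it passes through a halt on every input
  down to 0; since all its rows have equal length, the bound found at any halt applies to the first
  row.\<close>

lemma chain_bound:
  assumes out: "\<And>j. tm_outputs M (replicate j 2) (replicate (h j) 2)"
  shows "chain M u w \<Longrightarrow> u = row (marks p j r) q x y \<Longrightarrow> length x + length y = p + j + r \<Longrightarrow> y \<noteq> [] \<Longrightarrow>
    (tm_next M)\<^sup>*\<^sup>* (padded_start p j r) (q, rev x, y) \<Longrightarrow> i \<le> j \<Longrightarrow> h i \<le> length u"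
proof (induction arbitrary: p j r q x y rule: chain.induct)
  case (chain_stop u)
  have len: "length (marks p j r) = length x + length y" using chain_stop.prems by (simp add: length_marks)
  have "map mark u = marks p j r" using mark_row[OF len] chain_stop.prems by simp
  then have "mark ` set u = set (marks p j r)" by (metis set_map)
  then have "j = 0" using chain_stop.hyps(2) by (cases j) (auto simp: marks_def)
  moreover have "tm_delta M q (scan y) = None"
    using halting_row[OF len] chain_stop by blast
  then have "h j \<le> length y" using output_fits[OF out chain_stop.prems(4)] by blast
  ultimately show ?case using chain_stop.prems length_row[OF len] len by simp
next
  case (chain_step u v w)
  have len: "length (marks p j r) = length x + length y" using chain_step.prems by (simp add: length_marks)
  obtain q' x' y' where v: "v = row (marks p j r) q' x' y'" "row_step M (q, x, y) (q', x', y')"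
    using step_sound[OF len chain_step.prems(3)] chain_step.hyps(3) chain_step.prems(1) by blast
  note len' = row_step_length[OF v(2)]
  have "h i \<le> length v"
  proof (rule chain_step.IH[OF v(1)])
    show "(tm_next M)\<^sup>*\<^sup>* (padded_start p j r) (q', rev x', y')"
      using chain_step.prems(4) row_step_tm_step[OF v(2)] by (rule rtranclp.rtrancl_into_rtrancl)
  qed (use chain_step.prems len' in auto)
  then show ?case using pair_accepts_length[OF chain_step.hyps(3)] by simp
next
  case (chain_restart u v w)
  have len: "length (marks p j r) = length x + length y" using chain_restart.prems by (simp add: length_marks)
  have "map mark u = marks p j r" using mark_row[OF len] chain_restart.prems by simp
  then have v: "0 < j" "v = init_row p (j - 1) (Suc r)" using restart_iff chain_restart.hyps(3) by blast+
  show ?case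
  proof (cases "i = j")
    case True
    have "tm_delta M q (scan y) = None"
      using halting_row[OF len] chain_restart by blast
    then have "h j \<le> length y" using output_fits[OF out chain_restart.prems(4)] by blast
    then show ?thesis using True chain_restart.prems length_row[OF len] len by simp
  next
    case False
    have "h i \<le> length v"
      by (rule chain_restart.IH[OF v(2)[unfolded init_row_start]])
        (use False v(1) chain_restart.prems in \<open>auto simp: padded_start_def\<close>)
    then show ?thesis using pair_accepts_length[OF chain_restart.hyps(3)] by simp
  qed
qed

text \<open>A step uses up at most one cell of room on either side, so \<open>k\<close> bounds the
  further steps for which the segment surely suffices. The scanned cell belongs to \<open>y\<close>,
  hence the strict inequality there.\<close>

lemma tm_step_row_step:
  assumes wf: "tm_wf M" and step: "tm_next M (q, rev x, y) d"
    and room: "Suc k \<le> length x" "Suc k < length y"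
    and bounds: "q < tm_states M" "set x \<union> set y \<subseteq> {..<tm_syms M}"
  shows "\<exists>q' x' y'. d = (q', rev x', y') \<and> row_step M (q, x, y) (q', x', y') \<and> k \<le> length x' \<and> k < length y' \<and>
    q' < tm_states M \<and> set x' \<union> set y' \<subseteq> {..<tm_syms M}"
proof -
  obtain x0 c where x: "x = x0 @ [c]" using room(1) by (cases x rule: rev_cases) auto
  obtain a e y0 where y: "y = a # e # y0" using room(2) by (cases y; cases "tl y") auto
  obtain q' b m where \<delta>: "tm_delta M q a = Some (q', b, m)"
    using step y by (auto simp: scan_def split: option.splits)
  have "a < tm_syms M" using bounds y by auto
  then have q': "q' < tm_states M" "b < tm_syms M"
    using wf bounds(1) \<delta> unfolding tm_wf_def by metis+
  show ?thesis
  proof (cases m)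
    case MLeft
    then have "d = (q', rev x0, c # b # e # y0)" using step x y \<delta> by (auto simp: scan_def)
    then show ?thesis using row_left[of M q a q' b x0 c "e # y0"] \<delta> MLeft x y q' room bounds
      by (intro exI[of _ q'] exI[of _ x0] exI[of _ "c # b # e # y0"]) auto
  next
    case MStay
    then have "d = (q', rev x, b # e # y0)" using step x y \<delta> by (auto simp: scan_def)
    then show ?thesis using row_stay[of M q a q' b x "e # y0"] \<delta> MStay y q' room bounds
      by (intro exI[of _ q'] exI[of _ x] exI[of _ "b # e # y0"]) auto
  next
    case MRight
    then have "d = (q', rev (x @ [b]), e # y0)" using step x y \<delta> by (auto simp: scan_def)
    then show ?thesis using row_right[of M q a q' b x e y0] \<delta> MRight y q' room bounds
      by (intro exI[of _ q'] exI[of _ "x @ [b]"] exI[of _ "e # y0"]) auto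
  qed
qed

text \<open>The premise \<open>final\<close> abstracts what happens at the halt: the word ends on
  input 0 and restarts otherwise.\<close>

lemma chain_of_run:
  assumes wf: "tm_wf M" and ms: "set ms \<subseteq> {..<3}"
    and final: "\<And>q x y. tm_delta M q (scan y) = None \<Longrightarrow> y \<noteq> [] \<Longrightarrow> length ms = length x + length y \<Longrightarrow>
      row ms q x y \<in> lists (cells M) \<Longrightarrow> \<exists>w. chain M (row ms q x y) w"
  shows "(tm_next M ^^ k) (q, rev x, y) d \<Longrightarrow> tm_step M d = None \<Longrightarrow> k \<le> length x \<Longrightarrow> k < length y \<Longrightarrow>
    q < tm_states M \<Longrightarrow> set x \<union> set y \<subseteq> {..<tm_syms M} \<Longrightarrow> length ms = length x + length y \<Longrightarrow>
    \<exists>w. chain M (row ms q x y) w"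
proof (induction k arbitrary: q x y)
  case 0
  show ?case
  proof (rule final)
    show "tm_delta M q (scan y) = None" using "0.prems"(1,2) by (auto split: option.splits)
    show "y \<noteq> []" using "0.prems"(4) by auto
    show "row ms q x y \<in> lists (cells M)" by (rule row_in_cells[OF ms "0.prems"(5,6)])
  qed (rule "0.prems"(7))
next
  case (Suc k)
  from relpowp_Suc_D2[OF Suc.prems(1)] obtain e
    where e: "tm_next M (q, rev x, y) e" "(tm_next M ^^ k) e d" by blast
  obtain q' x' y' where e': "e = (q', rev x', y')" and step: "row_step M (q, x, y) (q', x', y')"
    and bounds: "k \<le> length x'" "k < length y'" "q' < tm_states M" "set x' \<union> set y' \<subseteq> {..<tm_syms M}"
    using tm_step_row_step[OF wf e(1) Suc.prems(3-6)] by blast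
  have len: "length ms = length x' + length y'" using row_step_length[OF step] Suc.prems(7) by simp
  obtain w where "chain M (row ms q' x' y') w"
    using Suc.IH[OF e(2)[unfolded e'] Suc.prems(2) bounds len] by blast
  then show ?case
    using chain_step[OF row_in_cells[OF ms Suc.prems(5,6)] row_in_cells[OF ms bounds(3,4)]
        step_complete[OF step Suc.prems(7)]] by blast
qed

lemma set_marks: "set (marks p j r) \<subseteq> {..<3}"
  by (auto simp: marks_def)

lemma tm_wfD: "tm_wf M \<Longrightarrow> 0 < tm_states M \<and> 0 < tm_syms M \<and> 2 < tm_syms M"
  unfolding tm_wf_def by linarith

lemma init_row_in_cells: "tm_wf M \<Longrightarrow> init_row p j r \<in> lists (cells M)"
  unfolding init_row_def by (rule row_in_cells[OF set_marks]) (auto dest: tm_wfD)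

text \<open>A run of at most \<open>B\<close> steps cannot leave a segment with \<open>B\<close>
  cells to the left of the start and more than \<open>B\<close> in the right margin. The induction
  varies \<open>r\<close>, because each restart enlarges the right margin by one.\<close>

lemma chain_exists:
  assumes wf: "tm_wf M"
    and halts: "\<And>i. i \<le> j \<Longrightarrow> \<exists>k\<le>B. \<exists>d. (tm_next M ^^ k) (0, [], replicate i 2) d \<and> tm_step M d = None"
  shows "B < r \<Longrightarrow> \<exists>w. chain M (init_row B j r) w"
  using halts
proof (induction j arbitrary: r)
  case (0 r)
  obtain k d where k: "k \<le> B" "(tm_next M ^^ k) (0, [], replicate 0 2) d" "tm_step M d = None"
    using "0.prems"(2)[of 0] by auto
  obtain d' where d': "(tm_next M ^^ k) (padded_start B 0 r) d'" "padded d d'"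
    using padded_steps[OF k(2) padded_start] by blast
  show ?case unfolding init_row_start
  proof (rule chain_of_run[OF wf set_marks, where k = k and d = d'])
    fix q x y let ?u = "row (marks B 0 r) q x y"
    assume *: "tm_delta M q (scan y) = None" "y \<noteq> []"
      and len: "length (marks B 0 r) = length x + length y" and u: "?u \<in> lists (cells M)"
    have "mark ` set ?u = set (marks B 0 r)" using mark_row[OF len *(2), of q] by (metis set_map)
    then have "1 \<notin> mark ` set ?u" by (auto simp: marks_def)
    then have "chain M ?u ?u"
      by (rule chain_stop[OF u _ halting_row[OF len *(2), THEN iffD2, OF *(1)]])
    then show "\<exists>w. chain M ?u w" ..
  qed (use d' k(1) padded_step_None[OF k(3) d'(2)] "0.prems"(1) tm_wfD[OF wf] in
    \<open>auto simp: padded_start_def length_marks\<close>)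
next
  case (Suc j r)
  obtain k d where k: "k \<le> B" "(tm_next M ^^ k) (0, [], replicate (Suc j) 2) d" "tm_step M d = None"
    using Suc.prems(2)[of "Suc j"] by auto
  obtain d' where d': "(tm_next M ^^ k) (padded_start B (Suc j) r) d'" "padded d d'"
    using padded_steps[OF k(2) padded_start] by blast
  obtain w where w: "chain M (init_row B j (Suc r)) w"
    using Suc.IH[of "Suc r"] Suc.prems by (meson le_SucI less_SucI)
  show ?case unfolding init_row_start
  proof (rule chain_of_run[OF wf set_marks, where k = k and d = d'])
    fix q x y let ?u = "row (marks B (Suc j) r) q x y"
    assume *: "tm_delta M q (scan y) = None" "y \<noteq> []"
      and len: "length (marks B (Suc j) r) = length x + length y" and u: "?u \<in> lists (cells M)"
    have "restart_accepts Left_part ?u (init_row B j (Suc r))"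
      using restart_iff[OF mark_row[OF len *(2), of q]] by simp
    then show "\<exists>w. chain M ?u w"
      using chain_restart[OF u init_row_in_cells[OF wf] _ halting_row[OF len *(2), THEN iffD2, OF *(1)] w]
      by blast
  qed (use d' k(1) padded_step_None[OF k(3) d'(2)] Suc.prems(1) tm_wfD[OF wf] in
    \<open>auto simp: padded_start_def length_marks\<close>)
qed

lemma valid_words_nonempty:
  assumes wf: "tm_wf M" and "0 < n" and out: "\<And>j. tm_outputs M (replicate j 2) (replicate (h j) 2)"
  shows "valid_words M n \<noteq> {}"
proof -
  let ?j = "n * Suc n"
  have "\<exists>k d. (tm_next M ^^ k) (0, [], replicate i 2) d \<and> tm_step M d = None" for i
    using out[of i] rtranclp_imp_relpowp unfolding tm_outputs_def by metis
  then have "\<forall>i. \<exists>k. \<exists>d. (tm_next M ^^ k) (0, [], replicate i 2) d \<and> tm_step M d = None" by simp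
  from choice[OF this] obtain k where
    k: "\<And>i. \<exists>d. (tm_next M ^^ k i) (0, [], replicate i 2) d \<and> tm_step M d = None" by blast
  \<comment> \<open>The sum of the running times bounds each of them.\<close>
  let ?B = "sum k {..?j}"
  have "k i \<le> ?B" if "i \<le> ?j" for i using that by (intro member_le_sum) auto
  then have "\<exists>w. chain M (init_row ?B ?j (Suc ?B)) w"
    by (intro chain_exists[OF wf]) (use k in blast, simp)
  then obtain w where "chain M (init_row ?B ?j (Suc ?B)) w" ..
  moreover have "0 < ?j" "0 < Suc ?B" "n dvd ?j" "Suc n dvd ?j"
    using \<open>0 < n\<close> by (simp_all del: mult_Suc_right)
  ultimately have "w \<in> valid_words M n" unfolding valid_words_def mem_Collect_eq by blast
  then show ?thesis by blast
qed

text \<open>Since \<open>n\<close> and \<open>Suc n\<close> are coprime, their product divides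
  \<open>j\<close>. The inequality is strict because a positive \<open>j\<close> leaves a mark 1 in
  the first row, so the chain cannot stop there.\<close>

lemma valid_words_long:
  assumes "w \<in> valid_words M n" and out: "\<And>j. tm_outputs M (replicate j 2) (replicate (h j) 2)"
    and "i \<le> n * Suc n"
  shows "h i < length w"
proof -
  obtain p j r where j: "0 < j" "0 < r" "n dvd j" "Suc n dvd j" and chain: "chain M (init_row p j r) w"
    using assms(1) unfolding valid_words_def by blast
  have "n * Suc n dvd j" by (rule divides_mult) (use j in auto)
  then have "n * Suc n \<le> j" using j(1) by (rule dvd_imp_le)
  then have "i \<le> j" using assms(3) by simp
  then have "h i \<le> length (init_row p j r)"
    by (intro chain_bound[OF out chain init_row_start]) (use j in \<open>auto simp: padded_start_def\<close>)
  also have "\<dots> < length w"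
    using chain
  proof cases
    case chain_stop
    moreover have "1 \<in> set (marks p j r)" using j(1) by (simp add: marks_def)
    moreover have "set (marks p j r) = mark ` set (init_row p j r)"
      using mark_init_row[of j r p] j(1) by (metis add_gr_0 set_map)
    ultimately show ?thesis by blast
  qed simp_all
  finally show ?thesis .
qed

section \<open>Languages whose complement has only long words\<close>

text \<open>The diagonal step: the same \<open>m\<close> bounds the size of the grammar and the
  arguments at which \<open>h\<close> is outgrown. The parameter \<open>c0\<close> makes room for
  the second grammar.\<close>

lemma short_words_insufficient:
  assumes "computable_nat_fun h"
  shows "\<exists>G m. standard_cfg G \<and> linear_cfg G \<and> c0 \<le> m \<and> cfg_size G \<le> m \<and>
    cfg_lang G \<noteq> (\<lambda>_. True) \<and> (\<forall>w. \<not> cfg_lang G w \<longrightarrow> (\<forall>i\<le>m. h i < length w))"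
proof -
  obtain M where wf: "tm_wf M" and out': "\<And>j. tm_outputs M (tape_nat j) (tape_nat (h j))"
    using assms unfolding computable_nat_fun_def tm_computable_on_def by blast
  have "tape_nat j = replicate j 2" for j by (simp add: tape_nat_def tape_str_def tape_bit_def)
  then have out: "tm_outputs M (replicate j 2) (replicate (h j) 2)" for j using out'[of j] by simp
  obtain K a where lin: "\<And>n. 0 < n \<Longrightarrow> lin 2 (K + a * n) (lists (letters M) - valid_words M n)"
    using lin_invalid_words[OF wf] by blast
  have "letters M \<noteq> {}" by (simp add: letters_def)
  then obtain e :: "letter list \<Rightarrow> bool list" and k r' where e: "\<And>w. length w \<le> length (e w)" and
    e_lin: "\<And>L b r. L \<subseteq> lists (letters M) \<Longrightarrow> lin b r (lists (letters M) - L) \<Longrightarrow> lin (k * b + 1) (r + r') (- e ` L)"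
    using lin_binary_compl[OF finite_letters[of M]] by metis
  \<comment> \<open>The width 2 becomes \<open>k * 2 + 1\<close> under the binary code; 4 is the
    overhead per rule in \<open>lin_imp_linear_cfg\<close>.\<close>
  let ?b = "k * 2 + 1 + 4"
  \<comment> \<open>\<open>n\<close> dominates the constant term and, separately, the coefficient of
    \<open>n\<close> in the size bound, which is thus at most \<open>n + n * n\<close>;
    \<open>c0\<close> ensures \<open>c0 \<le> ?m\<close>.\<close>
  define n where "n = Suc (3 + (K + r') * ?b + a * ?b + c0)"
  let ?m = "n * Suc n"
  have n: "0 < n" by (simp add: n_def)
  obtain G where G: "standard_cfg G" "linear_cfg G" "cfg_lang G = (\<lambda>w. w \<in> - e ` valid_words M n)"
    "cfg_size G \<le> 3 + (K + a * n + r') * ?b"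
    using lin_imp_linear_cfg[OF e_lin[OF valid_words_letters lin[OF n]]] by blast
  have "3 + (K + a * n + r') * ?b = 3 + (K + r') * ?b + a * ?b * n" by (simp add: algebra_simps)
  also have "\<dots> \<le> n + n * n"
    by (rule add_mono) (simp_all add: n_def)
  finally have "cfg_size G \<le> ?m" using G(4) by simp
  moreover have "c0 \<le> ?m"
  proof (rule le_trans)
    show "c0 \<le> n" by (simp add: n_def)
  qed simp
  moreover have "cfg_lang G \<noteq> (\<lambda>_. True)"
    using valid_words_nonempty[OF wf n out] G(3) by (auto dest: fun_cong)
  moreover have "h i < length w" if w: "\<not> cfg_lang G w" and i: "i \<le> ?m" for w i
  proof -
    obtain v where v: "v \<in> valid_words M n" "w = e v" using w G(3) by auto
    then show ?thesis using valid_words_long[OF v(1) out i] e[of v] unfolding v(2) by linarith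
  qed
  ultimately show ?thesis using G(1,2) by blast
qed

lemma linear_cfg_UNIV: "\<exists>G. standard_cfg G \<and> linear_cfg G \<and> cfg_lang G = (\<lambda>_. True)"
proof -
  have "lin 1 (card {()} * card (UNIV :: bool set) + card {()}) {w \<in> lists (UNIV :: bool set). \<not> False}"
    using lin_dfa_compl[of "{()}" "UNIV :: bool set" "()" "\<lambda>s a. ()" "\<lambda>s. False"] by simp
  then show ?thesis using lin_imp_linear_cfg by fastforce
qed

section \<open>Length generalization\<close>

lemma R_CFG_enc:
  assumes "cfg_encoding enc" "standard_cfg G"
  shows "R_CFG enc (enc G) = cfg_lang G"
proof -
  have "(THE G'. standard_cfg G' \<and> enc G' = enc G) = G"
    using assms by (intro the_equality) (auto simp: cfg_encoding_def inj_on_def)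
  then show ?thesis using assms(2) by (auto simp: R_CFG_def)
qed

lemma R_LCFG_enc:
  assumes "cfg_encoding enc" "standard_cfg G" "linear_cfg G"
  shows "R_LCFG enc (enc G) = cfg_lang G"
  using R_CFG_enc[OF assms(1,2)] assms(2,3) by (auto simp: R_LCFG_def)

lemma fun_complexity_le: "R p = f \<Longrightarrow> fun_complexity R C f \<le> C p"
  unfolding fun_complexity_def by (rule Least_le) blast

lemma Inf_enat_mem: "Inf X \<noteq> \<infinity> \<Longrightarrow> Inf X \<in> (X :: enat set)"
  by (cases "X = {}") (auto simp: Inf_enat_def intro: LeastI)

text \<open>A finite infimum in \<open>enat\<close> is attained, so some length not above
  \<open>N\<close> has the learning property for all larger ones.\<close>

lemma length_complexity_funD:
  assumes "length_complexity_fun R A f \<le> enat N" "N \<le> n"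
  shows "R (A (training_data n f)) = f"
proof -
  let ?X = "{enat N | N. \<forall>n\<ge>N. R (A (training_data n f)) = f}"
  have "Inf ?X \<noteq> \<infinity>"
  proof
    assume "Inf ?X = \<infinity>"
    then show False using assms(1) unfolding length_complexity_fun_def by simp
  qed
  then have "Inf ?X \<in> ?X" by (rule Inf_enat_mem)
  then show ?thesis using assms unfolding length_complexity_fun_def by auto
qed

lemma training_data_eq_UNIV:
  "(\<And>w. \<not> f w \<Longrightarrow> N < length w) \<Longrightarrow> training_data N f = training_data N (\<lambda>_. True)"
  unfolding training_data_def by (force simp: not_less)

lemma fun_complexity_R_CFG:
  assumes "cfg_encoding enc" "cfg_complexity enc C" "standard_cfg G"
  shows "fun_complexity (R_CFG enc) C (cfg_lang G) \<le> cfg_size G"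
  using fun_complexity_le[of "R_CFG enc" "enc G", OF R_CFG_enc[OF assms(1,3)], of C] assms(2,3)
  unfolding cfg_complexity_def by simp

lemma fun_complexity_R_LCFG:
  assumes "cfg_encoding enc" "cfg_complexity enc C" "standard_cfg G" "linear_cfg G"
  shows "fun_complexity (R_LCFG enc) C (cfg_lang G) \<le> cfg_size G"
  using fun_complexity_le[of "R_LCFG enc" "enc G", OF R_LCFG_enc[OF assms(1,3,4)], of C] assms(2,3)
  unfolding cfg_complexity_def by simp

text \<open>Both \<open>G\<close> and \<open>U\<close> have complexity at most \<open>m\<close> and
  the same training data up to length \<open>h m\<close>, so one output string would have to denote
  two languages.\<close>

lemma not_computably_bounded_R_LCFG:
  assumes enc: "cfg_encoding enc" and C: "cfg_complexity enc C"
  shows "\<not> computably_bounded (length_complexity (R_LCFG enc) C A)"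
proof
  let ?R = "R_LCFG enc"
  assume "computably_bounded (length_complexity ?R C A)"
  then obtain h where h: "computable_nat_fun h" "\<And>n. length_complexity ?R C A n \<le> enat (h n)"
    unfolding computably_bounded_def by blast
  obtain U where U: "standard_cfg U" "linear_cfg U" "cfg_lang U = (\<lambda>_. True)"
    using linear_cfg_UNIV by blast
  obtain G m where G: "standard_cfg G" "linear_cfg G" "cfg_size U \<le> m" "cfg_size G \<le> m"
    "cfg_lang G \<noteq> (\<lambda>_. True)" "\<And>w i. \<not> cfg_lang G w \<Longrightarrow> i \<le> m \<Longrightarrow> h i < length w"
    using short_words_insufficient[OF h(1), of "cfg_size U"] by blast
  have learns: "?R (A (training_data (h m) (cfg_lang K))) = cfg_lang K"
    if K: "standard_cfg K" "linear_cfg K" "cfg_size K \<le> m" for K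
  proof (rule length_complexity_funD[OF _ order_refl])
    have "cfg_lang K \<in> range ?R" using R_LCFG_enc[OF enc K(1,2)] by (metis rangeI)
    moreover have "fun_complexity ?R C (cfg_lang K) \<le> m"
      using fun_complexity_R_LCFG[OF enc C K(1,2)] K(3) by (rule le_trans)
    ultimately have "length_complexity_fun ?R A (cfg_lang K) \<le> length_complexity ?R C A m"
      unfolding length_complexity_def by (intro Sup_upper) blast
    then show "length_complexity_fun ?R A (cfg_lang K) \<le> enat (h m)" using h(2) by (rule order_trans)
  qed
  have same: "training_data (h m) (cfg_lang G) = training_data (h m) (cfg_lang U)"
    unfolding U(3) by (rule training_data_eq_UNIV) (rule G(6)[OF _ order_refl])
  have "cfg_lang G = ?R (A (training_data (h m) (cfg_lang G)))"
    by (rule learns[OF G(1,2,4), symmetric])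
  also have "\<dots> = cfg_lang U" unfolding same by (rule learns[OF U(1,2) G(3)])
  finally show False using G(5) U(3) by simp
qed

text \<open>The condition on \<open>F\<close> covers the linear class and the class of all grammars
  at once.\<close>

lemma not_admits_length_generalization_R_CFG:
  assumes enc: "cfg_encoding enc" and C: "cfg_complexity enc C"
    and F: "\<And>G. standard_cfg G \<Longrightarrow> linear_cfg G \<Longrightarrow> cfg_lang G \<in> F"
  shows "\<not> admits_length_generalization (R_CFG enc) C F"
proof
  let ?R = "R_CFG enc"
  assume "admits_length_generalization ?R C F"
  then obtain A h where h: "computable_nat_fun h"
    and A: "\<And>f n. f \<in> F \<Longrightarrow> h (fun_complexity ?R C f) \<le> n \<Longrightarrow> ?R (A (training_data n f)) = f"
    unfolding admits_length_generalization_def by blast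
  obtain U where U: "standard_cfg U" "linear_cfg U" "cfg_lang U = (\<lambda>_. True)"
    using linear_cfg_UNIV by blast
  obtain G m where G: "standard_cfg G" "linear_cfg G" "cfg_size U \<le> m" "cfg_size G \<le> m"
    "cfg_lang G \<noteq> (\<lambda>_. True)" "\<And>w i. \<not> cfg_lang G w \<Longrightarrow> i \<le> m \<Longrightarrow> h i < length w"
    using short_words_insufficient[OF h, of "cfg_size U"] by blast
  let ?k = "\<lambda>K. fun_complexity ?R C (cfg_lang K)"
  have k: "?k G \<le> m" "?k U \<le> m"
    using fun_complexity_R_CFG[OF enc C] U(1) G(1,3,4) by (meson le_trans)+
  \<comment> \<open>The two complexities may differ and lie below \<open>m\<close>; this is where
    \<open>G(6)\<close> is needed at arguments other than \<open>m\<close>.\<close>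
  define N where "N = max (h (?k G)) (h (?k U))"
  have same: "training_data N (cfg_lang G) = training_data N (cfg_lang U)"
    unfolding U(3) by (rule training_data_eq_UNIV) (use G(6) k in \<open>simp add: N_def\<close>)
  have "cfg_lang G = ?R (A (training_data N (cfg_lang G)))"
    by (rule A[OF F[OF G(1,2)], symmetric]) (simp add: N_def)
  also have "\<dots> = cfg_lang U"
    unfolding same by (rule A[OF F[OF U(1,2)]]) (simp add: N_def)
  finally show False using G(5) U(3) by simp
qed

theorem proposition4p6:
  fixes enc :: "cfg \<Rightarrow> str" and C :: "str \<Rightarrow> nat"
  assumes "cfg_encoding enc"
    and "cfg_complexity enc C"
  shows "(\<forall>A. learning_algorithm A \<longrightarrow>
            \<not> computably_bounded (length_complexity (R_LCFG enc) C A)) \<and>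
         \<not> admits_length_generalization (R_CFG enc) C F_LCFG \<and>
         \<not> admits_length_generalization (R_CFG enc) C (range (R_CFG enc))"
proof (intro conjI allI impI)
  show "\<not> computably_bounded (length_complexity (R_LCFG enc) C A)" for A
    by (rule not_computably_bounded_R_LCFG[OF assms])
  show "\<not> admits_length_generalization (R_CFG enc) C F_LCFG"
    by (rule not_admits_length_generalization_R_CFG[OF assms]) (auto simp: F_LCFG_def)
  show "\<not> admits_length_generalization (R_CFG enc) C (range (R_CFG enc))"
    by (rule not_admits_length_generalization_R_CFG[OF assms]) (metis R_CFG_enc[OF assms(1)] rangeI)
qed

end
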